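(* Let $(\mathbb A,\mathsf E,\mathsf M)$ be a context and let $f:(X,\mu)\to(Y,\phi)$, $g:(Y,\phi)\to(Z,\psi)$ be preneighbourhood morphisms. (a) The collection of separated morphisms contains all monomorphisms. (b) The collection of separated morphisms is pullback stable. (c) If $g$ and $f$ are separated then $g\circ f$ is separated. (d) If $g\circ f$ is separated and $f$ is a proper morphism, stably continuous and stably in $\mathsf E$, then $g$ is separated. (e) If $g\circ f$ is separated then $f$ is separated.
   Context: A context is a triple $(\mathbb A,\mathsf E,\mathsf M)$ where $\mathbb A$ is a finitely complete category with finite coproducts, $(\mathsf E,\mathsf M)$ is a proper factorization system on $\mathbb A$ ($\mathsf E\subseteq$ epimorphisms, $\mathsf M\subseteq$ monomorphisms), and for each object $X$ the poset $\mathrm{Sub}(X)$ of admissible subobjects of $X$ ($\mathsf M$-morphisms with codomain $X$, equivalent ones identified) is a complete lattice, with largest element $\mathrm{id}_X$ and smallest element $\sigma_X$ (the $\mathsf M$-part of the factorization of the unique morphism from the initial object to $X$). For $f:X\to Y$, $\exists_f m$ is the $\mathsf M$-part of the factorization of $f\circ m$ ($m\in\mathrm{Sub}(X)$) and $f^{-1}n$ is the pullback of $n\in\mathrm{Sub}(Y)$ along $f$. A filter on $X$ is an up-closed subset of $\mathrm{Sub}(X)$ closed under finite meets; filters $\mathrm{Fil}(X)$ are ordered by inclusion. A preneighbourhood system on $X$ is an order preserving map $\mu:\mathrm{Sub}(X)^{\mathrm{op}}\to\mathrm{Fil}(X)$ with $\mu(\sigma_X)=\mathrm{Sub}(X)$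 and $p\in\mu(m)\Rightarrow m\leq p$; $(X,\mu)$ is then an internal preneighbourhood space. A preneighbourhood morphism $f:(X,\mu)\to(Y,\phi)$ is a morphism $f:X\to Y$ such that $p\in\phi(u)\Rightarrow f^{-1}p\in\mu(f^{-1}u)$. Pullbacks (and all limits) of preneighbourhood spaces carry the smallest preneighbourhood system making the projections preneighbourhood morphisms. Define $\mathtt{Far}_\mu p=\{x\in\mathrm{Sub}(X):(\exists u\in\mu(x))(u\wedge p=\sigma_X)\}$, $\mathrm{cl}_\mu p=\bigvee\{x\in\mathrm{Sub}(X): p\not< x\text{ and }x\notin\mathtt{Far}_\mu p\}$, and $\mathfrak C_\mu=\{p:\mathrm{cl}_\mu p=p\}$. For preneighbourhood spaces $(X,\mu)$, $(Y,\phi)$, a morphism $f:X\to Y$ is closed if $p\in\mathfrak C_\mu\Rightarrow\exists_f p\in\mathfrak C_\phi$, and continuous if $t\in\mathfrak C_\phi\Rightarrow f^{-1}t\in\mathfrak C_\mu$. A preneighbourhood morphism $f$ is proper if its pullback along every preneighbourhood morphism is closed; it is stably continuous (stably in $\mathsf E$) if its pullback along every preneighbourhood morphism is continuous (in $\mathsf E$). For a preneighbourhood morphism $f:(X,\mu)\to(Y,\phi)$, let $X\times_Y X$ be its kernel pair with the pullback preneighbourhood system and $d_f=(\mathrm{id}_X,\mathrm{id}_X):(X,\mu)\to X\times_Y X$ the diagonal; $f$ is separated if $d_f$ is proper. *)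

theory Defs
  imports "HOL-Algebra.Complete_Lattice"
begin

section \<open>Categories\<close>

record ('o, 'a) category =
  Obj :: "'o set"
  Arr :: "'a set"
  Dom :: "'a \<Rightarrow> 'o"
  Cod :: "'a \<Rightarrow> 'o"
  Ident :: "'o \<Rightarrow> 'a"
  Comp :: "'a \<Rightarrow> 'a \<Rightarrow> 'a"  (infixl \<open>\<cdot>\<index>\<close> 75)

text \<open>\<open>g \<cdot> f\<close> is \<open>f\<close> followed by \<open>g\<close>; it is meaningful only if \<open>Cod f = Dom g\<close>.\<close>

definition hom :: "('o, 'a, 'z) category_scheme \<Rightarrow> 'o \<Rightarrow> 'o \<Rightarrow> 'a set" where
  "hom A X Y = {f \<in> Arr A. Dom A f = X \<and> Cod A f = Y}"

locale category =
  fixes A :: "('o, 'a, 'z) category_scheme" (structure)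
  assumes dom_cod: "f \<in> Arr A \<Longrightarrow> Dom A f \<in> Obj A \<and> Cod A f \<in> Obj A"
    and ident: "X \<in> Obj A \<Longrightarrow> Ident A X \<in> hom A X X"
    and comp: "f \<in> hom A X Y \<Longrightarrow> g \<in> hom A Y Z \<Longrightarrow> g \<cdot> f \<in> hom A X Z"
    and comp_ident: "f \<in> hom A X Y \<Longrightarrow> f \<cdot> Ident A X = f \<and> Ident A Y \<cdot> f = f"
    and assoc: "f \<in> hom A W X \<Longrightarrow> g \<in> hom A X Y \<Longrightarrow> h \<in> hom A Y Z \<Longrightarrow>
      h \<cdot> (g \<cdot> f) = (h \<cdot> g) \<cdot> f"

definition iso :: "('o, 'a, 'z) category_scheme \<Rightarrow> 'a \<Rightarrow> bool" where
  "iso A f \<longleftrightarrow> f \<in> Arr A \<and>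
     (\<exists>g \<in> hom A (Cod A f) (Dom A f).
        g \<cdot>\<^bsub>A\<^esub> f = Ident A (Dom A f) \<and> f \<cdot>\<^bsub>A\<^esub> g = Ident A (Cod A f))"

definition monic :: "('o, 'a, 'z) category_scheme \<Rightarrow> 'a \<Rightarrow> bool" where
  "monic A f \<longleftrightarrow> f \<in> Arr A \<and>
     (\<forall>W. \<forall>a \<in> hom A W (Dom A f). \<forall>b \<in> hom A W (Dom A f). f \<cdot>\<^bsub>A\<^esub> a = f \<cdot>\<^bsub>A\<^esub> b \<longrightarrow> a = b)"

definition epic :: "('o, 'a, 'z) category_scheme \<Rightarrow> 'a \<Rightarrow> bool" where
  "epic A f \<longleftrightarrow> f \<in> Arr A \<and>
     (\<forall>W. \<forall>a \<in> hom A (Cod A f) W. \<forall>b \<in> hom A (Cod A f) W. a \<cdot>\<^bsub>A\<^esub> f = b \<cdot>\<^bsub>A\<^esub> f \<longrightarrow> a = b)"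

definition initial :: "('o, 'a, 'z) category_scheme \<Rightarrow> 'o \<Rightarrow> bool" where
  "initial A I \<longleftrightarrow> I \<in> Obj A \<and> (\<forall>X \<in> Obj A. \<exists>!i. i \<in> hom A I X)"

text \<open>
  \<open>is_pullback A f g p q\<close>: the square \<open>f \<cdot> p = g \<cdot> q\<close> is a pullback, with \<open>p\<close> and \<open>q\<close> the
  projections to the domains of \<open>f\<close> and \<open>g\<close>.
\<close>

definition is_pullback ::
  "('o, 'a, 'z) category_scheme \<Rightarrow> 'a \<Rightarrow> 'a \<Rightarrow> 'a \<Rightarrow> 'a \<Rightarrow> bool" where
  "is_pullback A f g p q \<longleftrightarrow>
     f \<in> Arr A \<and> g \<in> Arr A \<and> Cod A f = Cod A g \<and>
     p \<in> Arr A \<and> q \<in> Arr A \<and> Dom A p = Dom A q \<and>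
     Cod A p = Dom A f \<and> Cod A q = Dom A g \<and> f \<cdot>\<^bsub>A\<^esub> p = g \<cdot>\<^bsub>A\<^esub> q \<and>
     (\<forall>W. \<forall>u \<in> hom A W (Dom A f). \<forall>v \<in> hom A W (Dom A g). f \<cdot>\<^bsub>A\<^esub> u = g \<cdot>\<^bsub>A\<^esub> v \<longrightarrow>
        (\<exists>!k. k \<in> hom A W (Dom A p) \<and> p \<cdot>\<^bsub>A\<^esub> k = u \<and> q \<cdot>\<^bsub>A\<^esub> k = v))"

text \<open>
  A finite diagram consists of a finite set \<open>V\<close> of vertices, an object \<open>D v\<close> for each vertex,
  and a finite set \<open>T\<close> of labelled edges \<open>(u, f, v)\<close> with \<open>f : D u \<rightarrow> D v\<close>. Limits of functors on
  finite categories are the special case in which \<open>T\<close> is the graph of the functor on arrows.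
\<close>

definition finite_diagram ::
  "('o, 'a, 'z) category_scheme \<Rightarrow> nat set \<Rightarrow> (nat \<Rightarrow> 'o) \<Rightarrow> (nat \<times> 'a \<times> nat) set \<Rightarrow> bool" where
  "finite_diagram A V D T \<longleftrightarrow>
     finite V \<and> (\<forall>v \<in> V. D v \<in> Obj A) \<and>
     finite T \<and> (\<forall>(u, f, v) \<in> T. u \<in> V \<and> v \<in> V \<and> f \<in> hom A (D u) (D v))"

definition is_cone ::
  "('o, 'a, 'z) category_scheme \<Rightarrow> nat set \<Rightarrow> (nat \<Rightarrow> 'o) \<Rightarrow> (nat \<times> 'a \<times> nat) set \<Rightarrow>
     'o \<Rightarrow> (nat \<Rightarrow> 'a) \<Rightarrow> bool" where
  "is_cone A V D T L c \<longleftrightarrow>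
     L \<in> Obj A \<and> (\<forall>v \<in> V. c v \<in> hom A L (D v)) \<and> (\<forall>(u, f, v) \<in> T. f \<cdot>\<^bsub>A\<^esub> c u = c v)"

definition is_limit ::
  "('o, 'a, 'z) category_scheme \<Rightarrow> nat set \<Rightarrow> (nat \<Rightarrow> 'o) \<Rightarrow> (nat \<times> 'a \<times> nat) set \<Rightarrow>
     'o \<Rightarrow> (nat \<Rightarrow> 'a) \<Rightarrow> bool" where
  "is_limit A V D T L c \<longleftrightarrow> is_cone A V D T L c \<and>
     (\<forall>W w. is_cone A V D T W w \<longrightarrow>
        (\<exists>!k. k \<in> hom A W L \<and> (\<forall>v \<in> V. c v \<cdot>\<^bsub>A\<^esub> k = w v)))"

definition finitely_complete :: "('o, 'a, 'z) category_scheme \<Rightarrow> bool" where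
  "finitely_complete A \<longleftrightarrow>
     (\<forall>V D T. finite_diagram A V D T \<longrightarrow> (\<exists>L c. is_limit A V D T L c))"

definition is_coproduct ::
  "('o, 'a, 'z) category_scheme \<Rightarrow> nat set \<Rightarrow> (nat \<Rightarrow> 'o) \<Rightarrow> 'o \<Rightarrow> (nat \<Rightarrow> 'a) \<Rightarrow> bool" where
  "is_coproduct A V D S c \<longleftrightarrow>
     S \<in> Obj A \<and> (\<forall>v \<in> V. c v \<in> hom A (D v) S) \<and>
     (\<forall>W \<in> Obj A. \<forall>w. (\<forall>v \<in> V. w v \<in> hom A (D v) W) \<longrightarrow>
        (\<exists>!k. k \<in> hom A S W \<and> (\<forall>v \<in> V. k \<cdot>\<^bsub>A\<^esub> c v = w v)))"

definition has_finite_coproducts :: "('o, 'a, 'z) category_scheme \<Rightarrow> bool" where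
  "has_finite_coproducts A \<longleftrightarrow>
     (\<forall>V D. finite V \<and> (\<forall>v \<in> V. D v \<in> Obj A) \<longrightarrow> (\<exists>S c. is_coproduct A V D S c))"


section \<open>Proper factorization systems and admissible subobjects\<close>

record ('o, 'a) fact_category = "('o, 'a) category" +
  EE :: "'a set"
  MM :: "'a set"

definition factorization_system :: "('o, 'a) fact_category \<Rightarrow> bool" where
  "factorization_system A \<longleftrightarrow>
     EE A \<subseteq> Arr A \<and> MM A \<subseteq> Arr A \<and>
     (\<forall>f. iso A f \<longrightarrow> f \<in> EE A \<and> f \<in> MM A) \<and>
     (\<forall>f \<in> EE A. \<forall>g \<in> EE A. Cod A f = Dom A g \<longrightarrow> g \<cdot>\<^bsub>A\<^esub> f \<in> EE A) \<and>
     (\<forall>f \<in> MM A. \<forall>g \<in> MM A. Cod A f = Dom A g \<longrightarrow> g \<cdot>\<^bsub>A\<^esub> f \<in> MM A) \<and>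
     (\<forall>f \<in> Arr A. \<exists>e \<in> EE A. \<exists>m \<in> MM A. Cod A e = Dom A m \<and> f = m \<cdot>\<^bsub>A\<^esub> e) \<and>
     (\<forall>e \<in> EE A. \<forall>m \<in> MM A. \<forall>u \<in> hom A (Dom A e) (Dom A m). \<forall>v \<in> hom A (Cod A e) (Cod A m).
        m \<cdot>\<^bsub>A\<^esub> u = v \<cdot>\<^bsub>A\<^esub> e \<longrightarrow>
        (\<exists>!d. d \<in> hom A (Cod A e) (Dom A m) \<and> d \<cdot>\<^bsub>A\<^esub> e = u \<and> m \<cdot>\<^bsub>A\<^esub> d = v))"

definition proper_factorization_system :: "('o, 'a) fact_category \<Rightarrow> bool" where
  "proper_factorization_system A \<longleftrightarrow>
     factorization_system A \<and> (\<forall>e \<in> EE A. epic A e) \<and> (\<forall>m \<in> MM A. monic A m)"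

definition factors_through :: "('o, 'a) fact_category \<Rightarrow> 'a \<Rightarrow> 'a \<Rightarrow> bool" where
  "factors_through A m n \<longleftrightarrow> (\<exists>k \<in> hom A (Dom A m) (Dom A n). m = n \<cdot>\<^bsub>A\<^esub> k)"

definition sub_class :: "('o, 'a) fact_category \<Rightarrow> 'a \<Rightarrow> 'a set" where
  "sub_class A m =
     {n \<in> MM A. Cod A n = Cod A m \<and> factors_through A m n \<and> factors_through A n m}"

text \<open>Admissible subobjects are equivalence classes of arrows in \<open>MM A\<close>.\<close>

definition SubO :: "('o, 'a) fact_category \<Rightarrow> 'o \<Rightarrow> 'a set gorder" where
  "SubO A X =
     \<lparr> carrier = sub_class A ` {m \<in> MM A. Cod A m = X},
       eq = (=),
       le = (\<lambda>p q. \<exists>m \<in> p. \<exists>n \<in> q. factors_through A m n) \<rparr>"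

abbreviation Sub :: "('o, 'a) fact_category \<Rightarrow> 'o \<Rightarrow> 'a set set" where
  "Sub A X \<equiv> carrier (SubO A X)"

text \<open>
  The operations below collect all admissible representatives of the subobject in question. The
  \<open>MM\<close>-part of a factorization, and a pullback, are unique precisely up to isomorphism, so
  each of the collected sets is a single equivalence class.
\<close>

definition M_part :: "('o, 'a) fact_category \<Rightarrow> 'a \<Rightarrow> 'a set" where
  "M_part A f = {m \<in> MM A. \<exists>e \<in> EE A. Cod A e = Dom A m \<and> f = m \<cdot>\<^bsub>A\<^esub> e}"

definition sub_bot :: "('o, 'a) fact_category \<Rightarrow> 'o \<Rightarrow> 'a set" where
  "sub_bot A X = (\<Union>I \<in> {I. initial A I}. \<Union>i \<in> hom A I X. M_part A i)"

definition img :: "('o, 'a) fact_category \<Rightarrow> 'a \<Rightarrow> 'a set \<Rightarrow> 'a set" where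
  "img A f p = (\<Union>m \<in> p. M_part A (f \<cdot>\<^bsub>A\<^esub> m))"

definition preimg :: "('o, 'a) fact_category \<Rightarrow> 'a \<Rightarrow> 'a set \<Rightarrow> 'a set" where
  "preimg A f q = {m. \<exists>n \<in> q. \<exists>k. is_pullback A f n m k}"

locale pnbd_context = category A
  for A :: "('o, 'a) fact_category" (structure) +
  assumes finitely_complete: "finitely_complete A"
    and finite_coproducts: "has_finite_coproducts A"
    and proper_fact: "proper_factorization_system A"
    and sub_complete: "X \<in> Obj A \<Longrightarrow> complete_lattice (SubO A X)"


section \<open>Preneighbourhood spaces\<close>

text \<open>The empty meet is included in the last clause, so a filter contains the largest subobject.\<close>

definition is_filter :: "('o, 'a) fact_category \<Rightarrow> 'o \<Rightarrow> 'a set set \<Rightarrow> bool" where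
  "is_filter A X F \<longleftrightarrow>
     F \<subseteq> Sub A X \<and>
     (\<forall>p \<in> F. \<forall>q \<in> Sub A X. p \<sqsubseteq>\<^bsub>SubO A X\<^esub> q \<longrightarrow> q \<in> F) \<and>
     (\<forall>S \<subseteq> F. finite S \<longrightarrow> \<Sqinter>\<^bsub>SubO A X\<^esub> S \<in> F)"

text \<open>Only the values of \<open>\<mu>\<close> on \<open>Sub A X\<close> matter, here and below.\<close>

type_synonym 'a pnbd = "'a set \<Rightarrow> 'a set set"

definition pnbd_system :: "('o, 'a) fact_category \<Rightarrow> 'o \<Rightarrow> 'a pnbd \<Rightarrow> bool" where
  "pnbd_system A X \<mu> \<longleftrightarrow>
     (\<forall>m \<in> Sub A X. is_filter A X (\<mu> m)) \<and>
     (\<forall>m \<in> Sub A X. \<forall>n \<in> Sub A X. m \<sqsubseteq>\<^bsub>SubO A X\<^esub> n \<longrightarrow> \<mu> n \<subseteq> \<mu> m) \<and>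
     \<mu> (sub_bot A X) = Sub A X \<and>
     (\<forall>m \<in> Sub A X. \<forall>p \<in> \<mu> m. m \<sqsubseteq>\<^bsub>SubO A X\<^esub> p)"

type_synonym ('o, 'a) space = "'o \<times> 'a pnbd"

definition pnbd_space :: "('o, 'a) fact_category \<Rightarrow> ('o, 'a) space \<Rightarrow> bool" where
  "pnbd_space A = (\<lambda>(X, \<mu>). X \<in> Obj A \<and> pnbd_system A X \<mu>)"

definition pnbd_mor ::
  "('o, 'a) fact_category \<Rightarrow> ('o, 'a) space \<Rightarrow> ('o, 'a) space \<Rightarrow> 'a \<Rightarrow> bool" where
  "pnbd_mor A = (\<lambda>(X, \<mu>) (Y, \<phi>) f.
     pnbd_space A (X, \<mu>) \<and> pnbd_space A (Y, \<phi>) \<and> f \<in> hom A X Y \<and>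
     (\<forall>u \<in> Sub A Y. \<forall>p \<in> \<phi> u. preimg A f p \<in> \<mu> (preimg A f u)))"

text \<open>Monomorphisms of the category of preneighbourhood spaces.\<close>

definition pnbd_monic ::
  "('o, 'a) fact_category \<Rightarrow> ('o, 'a) space \<Rightarrow> ('o, 'a) space \<Rightarrow> 'a \<Rightarrow> bool" where
  "pnbd_monic A S T f \<longleftrightarrow> pnbd_mor A S T f \<and>
     (\<forall>R a b. pnbd_mor A R S a \<and> pnbd_mor A R S b \<and> f \<cdot>\<^bsub>A\<^esub> a = f \<cdot>\<^bsub>A\<^esub> b \<longrightarrow> a = b)"

text \<open>
  \<open>pnbd_pullback A S T f g P p q\<close>: for \<open>f\<close> with domain \<open>S\<close> and \<open>g\<close> with domain \<open>T\<close>, the space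
  \<open>P\<close> is their pullback with projections \<open>p : P \<rightarrow> S\<close> and \<open>q : P \<rightarrow> T\<close>; preneighbourhood systems
  are compared pointwise.
\<close>

definition pnbd_pullback ::
  "('o, 'a) fact_category \<Rightarrow> ('o, 'a) space \<Rightarrow> ('o, 'a) space \<Rightarrow> 'a \<Rightarrow> 'a \<Rightarrow>
     ('o, 'a) space \<Rightarrow> 'a \<Rightarrow> 'a \<Rightarrow> bool" where
  "pnbd_pullback A S T f g = (\<lambda>(P, \<pi>) p q.
     is_pullback A f g p q \<and>
     pnbd_mor A (P, \<pi>) S p \<and> pnbd_mor A (P, \<pi>) T q \<and>
     (\<forall>\<pi>'. pnbd_mor A (P, \<pi>') S p \<and> pnbd_mor A (P, \<pi>') T q \<longrightarrow>
        (\<forall>m \<in> Sub A P. \<pi> m \<subseteq> \<pi>' m)))"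


section \<open>Closure; closed, continuous, proper and separated morphisms\<close>

definition Far :: "('o, 'a) fact_category \<Rightarrow> ('o, 'a) space \<Rightarrow> 'a set \<Rightarrow> 'a set set" where
  "Far A = (\<lambda>(X, \<mu>) p.
     {x \<in> Sub A X. \<exists>u \<in> \<mu> x. u \<sqinter>\<^bsub>SubO A X\<^esub> p = sub_bot A X})"

definition cl :: "('o, 'a) fact_category \<Rightarrow> ('o, 'a) space \<Rightarrow> 'a set \<Rightarrow> 'a set" where
  "cl A = (\<lambda>(X, \<mu>) p.
     \<Squnion>\<^bsub>SubO A X\<^esub> {x \<in> Sub A X. \<not> p \<sqsubset>\<^bsub>SubO A X\<^esub> x \<and> x \<notin> Far A (X, \<mu>) p})"

definition closed_subs :: "('o, 'a) fact_category \<Rightarrow> ('o, 'a) space \<Rightarrow> 'a set set" where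
  "closed_subs A S = {p \<in> Sub A (fst S). cl A S p = p}"

definition closed_mor ::
  "('o, 'a) fact_category \<Rightarrow> ('o, 'a) space \<Rightarrow> ('o, 'a) space \<Rightarrow> 'a \<Rightarrow> bool" where
  "closed_mor A S T f \<longleftrightarrow> f \<in> hom A (fst S) (fst T) \<and>
     (\<forall>p \<in> closed_subs A S. img A f p \<in> closed_subs A T)"

definition continuous_mor ::
  "('o, 'a) fact_category \<Rightarrow> ('o, 'a) space \<Rightarrow> ('o, 'a) space \<Rightarrow> 'a \<Rightarrow> bool" where
  "continuous_mor A S T f \<longleftrightarrow> f \<in> hom A (fst S) (fst T) \<and>
     (\<forall>t \<in> closed_subs A T. preimg A f t \<in> closed_subs A S)"

text \<open>The pullback of \<open>f\<close> along \<open>h : R \<rightarrow> T\<close> is the second projection \<open>q : P \<rightarrow> R\<close>.\<close>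

definition stably ::
  "(('o, 'a) space \<Rightarrow> ('o, 'a) space \<Rightarrow> 'a \<Rightarrow> bool) \<Rightarrow>
     ('o, 'a) fact_category \<Rightarrow> ('o, 'a) space \<Rightarrow> ('o, 'a) space \<Rightarrow> 'a \<Rightarrow> bool" where
  "stably Q A S T f \<longleftrightarrow> pnbd_mor A S T f \<and>
     (\<forall>R h P p q. pnbd_mor A R T h \<and> pnbd_pullback A S R f h P p q \<longrightarrow> Q P R q)"

definition proper_mor ::
  "('o, 'a) fact_category \<Rightarrow> ('o, 'a) space \<Rightarrow> ('o, 'a) space \<Rightarrow> 'a \<Rightarrow> bool" where
  "proper_mor A = stably (closed_mor A) A"

definition stably_continuous ::
  "('o, 'a) fact_category \<Rightarrow> ('o, 'a) space \<Rightarrow> ('o, 'a) space \<Rightarrow> 'a \<Rightarrow> bool" where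
  "stably_continuous A = stably (continuous_mor A) A"

definition stably_in_E ::
  "('o, 'a) fact_category \<Rightarrow> ('o, 'a) space \<Rightarrow> ('o, 'a) space \<Rightarrow> 'a \<Rightarrow> bool" where
  "stably_in_E A = stably (\<lambda>P R q. q \<in> EE A) A"

text \<open>\<open>K\<close> is the kernel pair of \<open>f\<close> with projections \<open>p\<close>, \<open>q\<close>, and \<open>d\<close> is its diagonal.\<close>

definition separated_mor ::
  "('o, 'a) fact_category \<Rightarrow> ('o, 'a) space \<Rightarrow> ('o, 'a) space \<Rightarrow> 'a \<Rightarrow> bool" where
  "separated_mor A S T f \<longleftrightarrow> pnbd_mor A S T f \<and>
     (\<forall>K p q d. pnbd_pullback A S S f f K p q \<and> d \<in> hom A (fst S) (fst K) \<and>
        p \<cdot>\<^bsub>A\<^esub> d = Ident A (fst S) \<and> q \<cdot>\<^bsub>A\<^esub> d = Ident A (fst S) \<longrightarrow>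
        proper_mor A S K d)"

end

theory Submission
  imports Defs
begin

text \<open>
  The closed subobjects of this theory are so rare that a preneighbourhood morphism
  \<open>f : X \<rightarrow> Y\<close> is separated if and only if \<open>f\<close> is a monomorphism of the underlying category
  (\<open>separated_iff_monic\<close>). All five assertions become elementary facts about monomorphisms.

  Unwinding the closure operator (\<open>closed_subs_iff\<close>), \<open>p\<close> is closed exactly when every
  subobject \<open>y\<close> is comparable with \<open>p\<close> or has a preneighbourhood disjoint from \<open>p\<close>; so a
  subobject that is not comparable with \<open>p\<close> has to be disjoint from \<open>p\<close>. Let \<open>p, q : K \<rightarrow> X\<close> be
  the kernel pair of \<open>f\<close> and \<open>d : X \<rightarrow> K\<close> its diagonal, and give \<open>W = K \<times>\<^sub>Y K\<close> the discrete
  system, in which the preneighbourhoods of \<open>m\<close> are all the subobjects above \<open>m\<close>. If \<open>d\<close> is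
  proper, then its pullback \<open>E\<close> along the first projection of \<open>W\<close> is a closed subobject. Compare
  \<open>E\<close> with the pullback \<open>F\<close> of \<open>d\<close> along the second projection. The generalized elements
  \<open>(1, d \<cdot> p)\<close> of \<open>F\<close> and \<open>(d \<cdot> p, 1)\<close> of \<open>E\<close> show that either inclusion between \<open>E\<close> and \<open>F\<close>
  lets the identity of \<open>K\<close> factor through \<open>d\<close>; and if \<open>E\<close> and \<open>F\<close> are disjoint, then their
  common element \<open>(d \<cdot> p, d \<cdot> q)\<close> lies in the smallest subobject, on which any two morphisms from
  \<open>W\<close> to \<open>X\<close> agree; composing the two projections of \<open>W\<close> with \<open>p\<close> then gives \<open>p = q\<close>. All
  three cases end with \<open>p = q\<close>, so \<open>f\<close> is monic (\<open>monic_if_separated\<close>).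

  Conversely, the diagonal of a monomorphism is an isomorphism. Kernel pairs and pullbacks carry
  the smallest possible system, hence one below the system transported along the isomorphism
  (\<open>push_pnbd\<close>), and therefore the diagonal is a morphism of spaces and its pullbacks are closed
  (\<open>proper_iso\<close>, \<open>separated_if_monic\<close>).

  Discrete spaces also show that monomorphisms of spaces are monic in the underlying category
  (\<open>monic_if_pnbd_monic\<close>), and that the pullbacks of a morphism stably in \<open>EE A\<close> along
  all morphisms of the underlying category lie in \<open>EE A\<close>. Since all morphisms in \<open>EE A\<close> are epic, two elements
  of \<open>Y\<close> identified by \<open>g\<close> can be lifted to \<open>X\<close> after precomposition with epimorphisms, which
  gives the descent of monicity from \<open>g \<cdot> f\<close> to \<open>g\<close> (\<open>monic_descends\<close>).
\<close>

section \<open>Pullbacks\<close>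

lemma homD: "f \<in> hom A X Y \<Longrightarrow> f \<in> Arr A \<and> Dom A f = X \<and> Cod A f = Y"
  by (simp add: hom_def)

lemma is_pullbackD:
  assumes "is_pullback A f g p q" "f \<in> hom A X Z" "g \<in> hom A Y Z"
  shows "p \<in> hom A (Dom A p) X" "q \<in> hom A (Dom A p) Y" "f \<cdot>\<^bsub>A\<^esub> p = g \<cdot>\<^bsub>A\<^esub> q"
  using assms unfolding is_pullback_def hom_def by auto

lemma is_pullback_lift:
  assumes "is_pullback A f g p q" "f \<in> hom A X Z" "g \<in> hom A Y Z"
    and "u \<in> hom A W X" "v \<in> hom A W Y" "f \<cdot>\<^bsub>A\<^esub> u = g \<cdot>\<^bsub>A\<^esub> v"
  obtains k where "k \<in> hom A W (Dom A p)" "p \<cdot>\<^bsub>A\<^esub> k = u" "q \<cdot>\<^bsub>A\<^esub> k = v"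
proof -
  have "Dom A f = X" "Dom A g = Y" using assms(2,3) by (simp_all add: hom_def)
  then have "\<exists>!k. k \<in> hom A W (Dom A p) \<and> p \<cdot>\<^bsub>A\<^esub> k = u \<and> q \<cdot>\<^bsub>A\<^esub> k = v"
    using assms(1,4-6) unfolding is_pullback_def by blast
  then show ?thesis using that by blast
qed

lemma is_pullback_sym: "is_pullback A f g p q \<Longrightarrow> is_pullback A g f q p"
  unfolding is_pullback_def by (safe; (metis | simp))

context category
begin

lemma is_pullback_eqI:
  assumes "is_pullback A f g p q" "f \<in> hom A X Z" "g \<in> hom A Y Z"
    and "a \<in> hom A W (Dom A p)" "b \<in> hom A W (Dom A p)" "p \<cdot> a = p \<cdot> b" "q \<cdot> a = q \<cdot> b"
  shows "a = b"
proof -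
  note pq = is_pullbackD[OF assms(1-3)]
  have D: "Dom A f = X" "Dom A g = Y" using assms(2,3) by (simp_all add: hom_def)
  have "f \<cdot> (p \<cdot> a) = g \<cdot> (q \<cdot> a)"
    using assoc[OF assms(4) pq(1) assms(2)] assoc[OF assms(4) pq(2) assms(3)] pq(3) by simp
  moreover have "p \<cdot> a \<in> hom A W X" "q \<cdot> a \<in> hom A W Y"
    by (rule comp[OF assms(4) pq(1)], rule comp[OF assms(4) pq(2)])
  ultimately have "\<exists>!k. k \<in> hom A W (Dom A p) \<and> p \<cdot> k = p \<cdot> a \<and> q \<cdot> k = q \<cdot> a"
    using assms(1) unfolding is_pullback_def D by blast
  then show ?thesis using assms(4-7) by metis
qed

lemma is_pullbackI:
  assumes "f \<in> hom A X Z" "g \<in> hom A Y Z" "p \<in> hom A P X" "q \<in> hom A P Y" "f \<cdot> p = g \<cdot> q"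
    and "\<And>W u v. u \<in> hom A W X \<Longrightarrow> v \<in> hom A W Y \<Longrightarrow> f \<cdot> u = g \<cdot> v \<Longrightarrow>
      \<exists>k \<in> hom A W P. p \<cdot> k = u \<and> q \<cdot> k = v"
    and "\<And>W a b. a \<in> hom A W P \<Longrightarrow> b \<in> hom A W P \<Longrightarrow> p \<cdot> a = p \<cdot> b \<Longrightarrow> q \<cdot> a = q \<cdot> b \<Longrightarrow>
      a = b"
  shows "is_pullback A f g p q"
proof -
  have "\<exists>!k. k \<in> hom A W P \<and> p \<cdot> k = u \<and> q \<cdot> k = v"
    if uv: "u \<in> hom A W X" "v \<in> hom A W Y" "f \<cdot> u = g \<cdot> v" for W u v
    using assms(6)[OF uv] assms(7) by (metis (no_types, lifting))
  then show ?thesis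
    using assms(1-5) unfolding is_pullback_def hom_def by auto
qed

lemma monicD:
  assumes "monic A f" "f \<in> hom A X Y" "a \<in> hom A W X" "b \<in> hom A W X" "f \<cdot> a = f \<cdot> b"
  shows "a = b"
  using assms unfolding monic_def by (metis homD)

lemma epicD:
  assumes "epic A f" "f \<in> hom A X Y" "a \<in> hom A Y W" "b \<in> hom A Y W" "a \<cdot> f = b \<cdot> f"
  shows "a = b"
  using assms unfolding epic_def by (metis homD)

lemma isoI:
  assumes "f \<in> hom A X Y" "g \<in> hom A Y X" "g \<cdot> f = Ident A X" "f \<cdot> g = Ident A Y"
  shows "iso A f"
  using assms unfolding iso_def hom_def by auto

lemma monic_pullback:
  assumes "is_pullback A f g p q" "f \<in> hom A X Z" "g \<in> hom A Y Z" "monic A f"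
  shows "monic A q"
  unfolding monic_def
proof (intro conjI allI ballI impI)
  note pq = is_pullbackD[OF assms(1-3)]
  show "q \<in> Arr A" using pq by (simp add: hom_def)
  have D: "Dom A q = Dom A p" using pq by (simp add: hom_def)
  fix W a b assume "a \<in> hom A W (Dom A q)" "b \<in> hom A W (Dom A q)" and e: "q \<cdot> a = q \<cdot> b"
  then have a: "a \<in> hom A W (Dom A p)" and b: "b \<in> hom A W (Dom A p)" by (simp_all add: D)
  have "f \<cdot> (p \<cdot> a) = f \<cdot> (p \<cdot> b)"
    using assoc[OF a pq(1) assms(2)] assoc[OF b pq(1) assms(2)] assoc[OF a pq(2) assms(3)]
      assoc[OF b pq(2) assms(3)] pq(3) e by simp
  then have "p \<cdot> a = p \<cdot> b"
    by (rule monicD[OF assms(4,2) comp[OF a pq(1)] comp[OF b pq(1)]])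
  then show "a = b" using e by (rule is_pullback_eqI[OF assms(1-3) a b])
qed

lemma monic_factor_inverse:
  assumes "monic A m" "m \<in> hom A M X" "n \<in> hom A N X" "a \<in> hom A M N" "b \<in> hom A N M"
    and "m = n \<cdot> a" "n = m \<cdot> b"
  shows "b \<cdot> a = Ident A M"
proof (rule monicD[OF assms(1,2)])
  show "b \<cdot> a \<in> hom A M M" by (rule comp[OF assms(4,5)])
  show "Ident A M \<in> hom A M M" using ident dom_cod assms(2) by (auto simp: hom_def)
  have "m \<cdot> (b \<cdot> a) = n \<cdot> a" unfolding assms(7) by (rule assoc[OF assms(4,5,2)])
  also have "\<dots> = m" by (rule assms(6)[symmetric])
  finally show "m \<cdot> (b \<cdot> a) = m \<cdot> Ident A M" using comp_ident[OF assms(2)] by simp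
qed

lemma monic_comp_cancel:
  assumes "monic A (g \<cdot> f)" "f \<in> hom A X Y" "g \<in> hom A Y Z"
  shows "monic A f"
  unfolding monic_def
proof (intro conjI allI ballI impI)
  show "f \<in> Arr A" using assms by (simp add: hom_def)
  fix W a b assume "a \<in> hom A W (Dom A f)" "b \<in> hom A W (Dom A f)" and e: "f \<cdot> a = f \<cdot> b"
  then have a: "a \<in> hom A W X" and b: "b \<in> hom A W X" using assms by (simp_all add: hom_def)
  show "a = b"
    using monicD[OF assms(1) comp[OF assms(2,3)] a b] assoc[OF a assms(2,3)]
      assoc[OF b assms(2,3)] e by simp
qed

lemma monic_comp:
  assumes "monic A g" "monic A f" "f \<in> hom A X Y" "g \<in> hom A Y Z"
  shows "monic A (g \<cdot> f)"
  unfolding monic_def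
proof (intro conjI allI ballI impI)
  have gf: "g \<cdot> f \<in> hom A X Z" using comp assms by blast
  then show "g \<cdot> f \<in> Arr A" by (simp add: hom_def)
  fix W a b
  assume "a \<in> hom A W (Dom A (g \<cdot> f))" "b \<in> hom A W (Dom A (g \<cdot> f))"
    and e: "(g \<cdot> f) \<cdot> a = (g \<cdot> f) \<cdot> b"
  then have a: "a \<in> hom A W X" and b: "b \<in> hom A W X" using gf by (simp_all add: hom_def)
  have "g \<cdot> (f \<cdot> a) = g \<cdot> (f \<cdot> b)"
    using e assoc[OF a assms(3,4)] assoc[OF b assms(3,4)] by simp
  then have "f \<cdot> a = f \<cdot> b"
    by (rule monicD[OF assms(1,4) comp[OF a assms(3)] comp[OF b assms(3)]])
  then show "a = b" by (rule monicD[OF assms(2,3) a b])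
qed

end

section \<open>Admissible subobjects through generalized elements\<close>

text \<open>
  A morphism \<open>w : V \<rightarrow> X\<close> is regarded as a generalized element of \<open>X\<close>, and subobjects as sets of
  such elements. Inclusion, preimages and disjointness can then be tested elementwise, without
  choosing pullback squares.
\<close>
definition belongs :: "('o, 'a) fact_category \<Rightarrow> 'a \<Rightarrow> 'a set \<Rightarrow> bool" where
  "belongs A w x \<longleftrightarrow> (\<exists>m \<in> x. factors_through A w m)"

context pnbd_context
begin

lemma fact_system: "factorization_system A"
  using proper_fact by (simp add: proper_factorization_system_def)

lemma MM_hom: "m \<in> MM A \<Longrightarrow> m \<in> hom A (Dom A m) (Cod A m)"
  using fact_system unfolding factorization_system_def hom_def by auto

lemma EE_hom: "m \<in> EE A \<Longrightarrow> m \<in> hom A (Dom A m) (Cod A m)"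
  using fact_system unfolding factorization_system_def hom_def by auto

lemma MM_monic: "m \<in> MM A \<Longrightarrow> monic A m"
  using proper_fact by (simp add: proper_factorization_system_def)

lemma EE_epic: "m \<in> EE A \<Longrightarrow> epic A m"
  using proper_fact by (simp add: proper_factorization_system_def)

lemma iso_MM: "iso A m \<Longrightarrow> m \<in> MM A"
  using fact_system by (simp add: factorization_system_def)

lemma iso_EE: "iso A m \<Longrightarrow> m \<in> EE A"
  using fact_system by (simp add: factorization_system_def)

lemma MM_comp: "f \<in> MM A \<Longrightarrow> g \<in> MM A \<Longrightarrow> Cod A f = Dom A g \<Longrightarrow> g \<cdot> f \<in> MM A"
  using fact_system by (simp add: factorization_system_def)

lemma EE_comp: "f \<in> EE A \<Longrightarrow> g \<in> EE A \<Longrightarrow> Cod A f = Dom A g \<Longrightarrow> g \<cdot> f \<in> EE A"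
  using fact_system by (simp add: factorization_system_def)

lemma factorize:
  assumes "f \<in> hom A X Y"
  obtains e m where "e \<in> EE A" "m \<in> MM A" "e \<in> hom A X (Dom A m)" "m \<in> hom A (Dom A m) Y"
    "f = m \<cdot> e"
proof -
  obtain e m where em: "e \<in> EE A" "m \<in> MM A" "Cod A e = Dom A m" "f = m \<cdot> e"
    using fact_system homD[OF assms] unfolding factorization_system_def by blast
  have e: "e \<in> hom A (Dom A e) (Dom A m)" using EE_hom[OF em(1)] em(3) by simp
  note m = MM_hom[OF em(2)]
  have D: "Dom A e = X" "Cod A m = Y" using comp[OF e m] assms em(4) by (auto simp: hom_def)
  show ?thesis using that[OF em(1,2) e[unfolded D] m[unfolded D] em(4)] .
qed

lemma diagonal_fill:
  assumes "e \<in> EE A" "m \<in> MM A" "e \<in> hom A P Q" "m \<in> hom A R S" "u \<in> hom A P R" "v \<in> hom A Q S"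
    "m \<cdot> u = v \<cdot> e"
  obtains d where "d \<in> hom A Q R" "d \<cdot> e = u" "m \<cdot> d = v"
proof -
  have D: "Dom A e = P" "Cod A e = Q" "Dom A m = R" "Cod A m = S"
    using assms(3,4) by (simp_all add: hom_def)
  have "\<forall>e \<in> EE A. \<forall>m \<in> MM A. \<forall>u \<in> hom A (Dom A e) (Dom A m).
      \<forall>v \<in> hom A (Cod A e) (Cod A m). m \<cdot> u = v \<cdot> e \<longrightarrow>
        (\<exists>!d. d \<in> hom A (Cod A e) (Dom A m) \<and> d \<cdot> e = u \<and> m \<cdot> d = v)"
    using fact_system unfolding factorization_system_def by (elim conjE)
  from this[rule_format, OF assms(1,2), unfolded D, OF assms(5-7)]
  have "\<exists>!d. d \<in> hom A Q R \<and> d \<cdot> e = u \<and> m \<cdot> d = v" .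
  then show ?thesis using that by blast
qed

lemma Ident_iso: "X \<in> Obj A \<Longrightarrow> iso A (Ident A X)"
  using isoI[OF ident ident] comp_ident[OF ident] by blast

lemma Obj_hom: "f \<in> hom A X Y \<Longrightarrow> X \<in> Obj A \<and> Y \<in> Obj A"
  using dom_cod by (auto simp: hom_def)

lemma split_epic_monic_iso:
  assumes "e \<in> hom A X Y" "r \<in> hom A Y X" "r \<cdot> e = Ident A X" "epic A e"
  shows "e \<cdot> r = Ident A Y"
proof -
  have "(e \<cdot> r) \<cdot> e = Ident A Y \<cdot> e"
    using assoc[OF assms(1,2,1)] assms(3) comp_ident[OF assms(1)] by simp
  moreover have "Ident A Y \<in> hom A Y Y" using ident Obj_hom assms(1) by blast
  ultimately show ?thesis using epicD[OF assms(4,1) comp[OF assms(2,1)]] by blast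
qed

text \<open>
  The \<open>EE A\<close>-part of a split monomorphism is epic and split monic, hence an isomorphism.
\<close>
lemma split_monic_MM:
  assumes "d \<in> hom A X Y" "r \<in> hom A Y X" "r \<cdot> d = Ident A X"
  shows "d \<in> MM A"
proof -
  obtain e m where em: "e \<in> EE A" "m \<in> MM A" "e \<in> hom A X (Dom A m)" "m \<in> hom A (Dom A m) Y"
    "d = m \<cdot> e" using factorize[OF assms(1)] by metis
  have rm: "r \<cdot> m \<in> hom A (Dom A m) X" using comp em assms by blast
  have "(r \<cdot> m) \<cdot> e = Ident A X" using assoc[OF em(3,4) assms(2)] em assms by simp
  then have "iso A e"
    using split_epic_monic_iso[OF em(3) rm] isoI[OF em(3) rm] EE_epic em(1) by blast
  then show ?thesis using MM_comp[OF iso_MM em(2)] em by (simp add: hom_def)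
qed

text \<open>
  If \<open>k = m \<cdot> e\<close> is the factorization of the pulled back morphism, the diagonal fill-in makes \<open>m\<close>
  part of a second cone over the same cospan. The comparison with the pullback inverts \<open>e\<close>.
\<close>
lemma MM_pullback:
  assumes pb: "is_pullback A f n k l" and f: "f \<in> hom A X Y" and nM: "n \<in> MM A"
    and n: "n \<in> hom A N Y"
  shows "k \<in> MM A"
proof -
  note kl = is_pullbackD[OF pb f n]
  obtain e m where em: "e \<in> EE A" "m \<in> MM A" "e \<in> hom A (Dom A k) (Dom A m)"
    "m \<in> hom A (Dom A m) X" "k = m \<cdot> e" using factorize[OF kl(1)] by metis
  have fm: "f \<cdot> m \<in> hom A (Dom A m) Y" using comp em f by blast
  have sq: "n \<cdot> l = (f \<cdot> m) \<cdot> e" using kl em assoc[OF em(3,4) f] by simp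
  obtain d where d: "d \<in> hom A (Dom A m) N" "d \<cdot> e = l" "n \<cdot> d = f \<cdot> m"
    using diagonal_fill[OF em(1) nM em(3) n kl(2) fm sq] by metis
  obtain t where t: "t \<in> hom A (Dom A m) (Dom A k)" "k \<cdot> t = m" "l \<cdot> t = d"
    using is_pullback_lift[OF pb f n em(4) d(1)] d(3) by metis
  have te: "t \<cdot> e = Ident A (Dom A k)"
  proof (rule is_pullback_eqI[OF pb f n])
    show "t \<cdot> e \<in> hom A (Dom A k) (Dom A k)" using comp em t by blast
    show "Ident A (Dom A k) \<in> hom A (Dom A k) (Dom A k)" using ident Obj_hom kl by blast
    show "k \<cdot> (t \<cdot> e) = k \<cdot> Ident A (Dom A k)"
      using assoc[OF em(3) t(1) kl(1)] t em comp_ident[OF kl(1)] by simp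
    show "l \<cdot> (t \<cdot> e) = l \<cdot> Ident A (Dom A k)"
      using assoc[OF em(3) t(1) kl(2)] t d comp_ident[OF kl(2)] by simp
  qed
  have "iso A e"
    using split_epic_monic_iso[OF em(3) t(1) te] isoI[OF em(3) t(1) te] EE_epic em(1) by blast
  then show ?thesis using MM_comp[OF iso_MM em(2)] em by (simp add: hom_def)
qed

lemma pullback_exists:
  assumes f: "f \<in> hom A X Z" and g: "g \<in> hom A Y Z"
  obtains P p q where "is_pullback A f g p q" "p \<in> hom A P X" "q \<in> hom A P Y"
proof -
  let ?D = "\<lambda>n::nat. if n = 0 then X else if n = 1 then Y else Z"
  let ?V = "{0,1,2::nat}" and ?T = "{(0,f,2),(1,g,2::nat)}"
  have ob: "X \<in> Obj A" "Y \<in> Obj A" "Z \<in> Obj A" using Obj_hom f g by blast+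
  have "finite_diagram A ?V ?D ?T" using f g ob by (auto simp: finite_diagram_def)
  then obtain L c where lim: "is_limit A ?V ?D ?T L c"
    using finitely_complete unfolding finitely_complete_def by blast
  have cone: "is_cone A ?V ?D ?T W w \<longleftrightarrow> w 0 \<in> hom A W X \<and> w 1 \<in> hom A W Y \<and> w 2 \<in> hom A W Z \<and>
      f \<cdot> w 0 = w 2 \<and> g \<cdot> w 1 = w 2" for W w
    unfolding is_cone_def using Obj_hom[of "w 0" W X] by (simp; blast)
  have c: "c 0 \<in> hom A L X" "c 1 \<in> hom A L Y" "c 2 \<in> hom A L Z" "f \<cdot> c 0 = c 2" "g \<cdot> c 1 = c 2"
    using lim cone unfolding is_limit_def by auto
  have uni: "\<exists>!k. k \<in> hom A W L \<and> (\<forall>v \<in> ?V. c v \<cdot> k = w v)"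
    if "is_cone A ?V ?D ?T W w" for W w
    using lim that unfolding is_limit_def by blast
  have "is_pullback A f g (c 0) (c 1)"
  proof (rule is_pullbackI[OF f g c(1,2)])
    show "f \<cdot> c 0 = g \<cdot> c 1" using c by simp
  next
    fix W u v assume u: "u \<in> hom A W X" and v: "v \<in> hom A W Y" and e: "f \<cdot> u = g \<cdot> v"
    have "is_cone A ?V ?D ?T W (\<lambda>n. if n = 0 then u else if n = 1 then v else f \<cdot> u)"
      unfolding cone using u v e comp[OF u f] by simp
    from uni[OF this] show "\<exists>k \<in> hom A W L. c 0 \<cdot> k = u \<and> c 1 \<cdot> k = v" by auto
  next
    fix W a b assume a: "a \<in> hom A W L" and b: "b \<in> hom A W L"
      and e: "c 0 \<cdot> a = c 0 \<cdot> b" "c 1 \<cdot> a = c 1 \<cdot> b"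
    have ca: "c 2 \<cdot> a = f \<cdot> (c 0 \<cdot> a)" "c 2 \<cdot> a = g \<cdot> (c 1 \<cdot> a)"
      using assoc[OF a c(1) f] assoc[OF a c(2) g] unfolding c by metis+
    have "c 2 \<cdot> b = f \<cdot> (c 0 \<cdot> b)" using assoc[OF b c(1) f] unfolding c by metis
    with ca e have e2: "c 2 \<cdot> a = c 2 \<cdot> b" by metis
    have "is_cone A ?V ?D ?T W (\<lambda>n. c n \<cdot> a)" unfolding cone
      using comp[OF a c(1)] comp[OF a c(2)] comp[OF a c(3)] ca by metis
    from uni[OF this] e e2 a b show "a = b" by auto
  qed
  then show ?thesis using that c by blast
qed

lemma factors_refl: "w \<in> hom A V X \<Longrightarrow> factors_through A w w"
  unfolding factors_through_def using comp_ident[of w V X] ident[of V] Obj_hom[of w V X] homD[of w A V X]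
  by metis

lemma factors_trans:
  assumes "factors_through A w m" "factors_through A m n" "m \<in> hom A M X" "n \<in> hom A N X"
  shows "factors_through A w n"
proof -
  have D: "Dom A m = M" "Dom A n = N" using assms(3,4) by (simp_all add: hom_def)
  obtain k l where k: "k \<in> hom A (Dom A w) M" "w = m \<cdot> k" and l: "l \<in> hom A M N" "m = n \<cdot> l"
    using assms(1,2) unfolding factors_through_def D by blast
  have "w = n \<cdot> (l \<cdot> k)" using assoc[OF k(1) l(1) assms(4)] k(2) l(2) by simp
  then show ?thesis unfolding factors_through_def D using comp[OF k(1) l(1)] by blast
qed

lemma Sub_iff: "x \<in> Sub A X \<longleftrightarrow> (\<exists>m. m \<in> MM A \<and> Cod A m = X \<and> x = sub_class A m)"
  by (auto simp: SubO_def)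

lemma sub_classI: "m \<in> MM A \<Longrightarrow> m \<in> hom A M X \<Longrightarrow> sub_class A m \<in> Sub A X"
  by (auto simp: Sub_iff hom_def)

lemma Sub_cases:
  assumes "x \<in> Sub A X"
  obtains m M where "m \<in> MM A" "m \<in> hom A M X" "x = sub_class A m"
  using assms MM_hom by (auto simp: Sub_iff)

lemma belongs_class:
  assumes "m \<in> MM A" "m \<in> hom A M X"
  shows "belongs A w (sub_class A m) \<longleftrightarrow> factors_through A w m"
proof
  assume "belongs A w (sub_class A m)"
  then obtain n where n: "n \<in> MM A" "Cod A n = X" "factors_through A n m" "factors_through A w n"
    using assms by (auto simp: belongs_def sub_class_def hom_def)
  show "factors_through A w m" using factors_trans[OF n(4,3)] MM_hom n assms by metis
next
  assume "factors_through A w m"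
  then show "belongs A w (sub_class A m)"
    using assms factors_refl[OF assms(2)] by (auto simp: belongs_def sub_class_def)
qed

lemma belongs_factor:
  assumes "m \<in> MM A" "m \<in> hom A M X" "w \<in> hom A V X"
  shows "belongs A w (sub_class A m) \<longleftrightarrow> (\<exists>k \<in> hom A V M. w = m \<cdot> k)"
  using assms by (simp add: belongs_class[OF assms(1,2)] factors_through_def hom_def)

lemma le_class:
  assumes "m \<in> MM A" "m \<in> hom A M X" "n \<in> MM A" "n \<in> hom A N X"
  shows "sub_class A m \<sqsubseteq>\<^bsub>SubO A X\<^esub> sub_class A n \<longleftrightarrow> factors_through A m n"
proof
  assume "sub_class A m \<sqsubseteq>\<^bsub>SubO A X\<^esub> sub_class A n"
  then obtain a b where ab: "a \<in> sub_class A m" "b \<in> sub_class A n" "factors_through A a b"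
    by (auto simp: SubO_def)
  have h: "a \<in> hom A (Dom A a) X" "b \<in> hom A (Dom A b) X"
    using ab assms MM_hom[of a] MM_hom[of b] by (auto simp: sub_class_def hom_def)
  have "factors_through A m a" "factors_through A b n" using ab by (auto simp: sub_class_def)
  then show "factors_through A m n" using factors_trans ab(3) h assms by metis
next
  assume "factors_through A m n"
  then show "sub_class A m \<sqsubseteq>\<^bsub>SubO A X\<^esub> sub_class A n"
    using assms factors_refl[OF assms(2)] factors_refl[OF assms(4)]
    by (auto simp: SubO_def sub_class_def)
qed

lemma le_iff:
  assumes "x \<in> Sub A X" "y \<in> Sub A X"
  shows "x \<sqsubseteq>\<^bsub>SubO A X\<^esub> y \<longleftrightarrow> (\<forall>V. \<forall>w \<in> hom A V X. belongs A w x \<longrightarrow> belongs A w y)"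
proof -
  obtain m M where m: "m \<in> MM A" "m \<in> hom A M X" "x = sub_class A m" using Sub_cases assms(1) .
  obtain n N where n: "n \<in> MM A" "n \<in> hom A N X" "y = sub_class A n" using Sub_cases assms(2) .
  show ?thesis
    unfolding m(3) n(3) le_class[OF m(1,2) n(1,2)] belongs_class[OF m(1,2)] belongs_class[OF n(1,2)]
    using factors_trans[OF _ _ m(2) n(2)] factors_refl[OF m(2)] m(2) by metis
qed

lemma Sub_eqI:
  assumes "x \<in> Sub A X" "y \<in> Sub A X"
    and "\<And>V w. w \<in> hom A V X \<Longrightarrow> belongs A w x \<longleftrightarrow> belongs A w y"
  shows "x = y"
proof -
  have "X \<in> Obj A" using assms(1) Sub_cases Obj_hom by metis
  then interpret L: complete_lattice "SubO A X" by (rule sub_complete)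
  show ?thesis using L.le_antisym assms le_iff by metis
qed

lemma sub_class_iso:
  assumes m: "m \<in> MM A" "m \<in> hom A M X" and n: "n \<in> sub_class A m"
  obtains N a b where "n \<in> MM A" "n \<in> hom A N X" "a \<in> hom A M N" "b \<in> hom A N M"
    "m = n \<cdot> a" "n = m \<cdot> b" "b \<cdot> a = Ident A M" "a \<cdot> b = Ident A N"
proof -
  have D: "Dom A m = M" "Cod A m = X" using m(2) by (simp_all add: hom_def)
  have nM: "n \<in> MM A" "n \<in> hom A (Dom A n) X"
    using n MM_hom[of n] by (auto simp: sub_class_def D)
  obtain a where a: "a \<in> hom A M (Dom A n)" "m = n \<cdot> a"
    using n unfolding sub_class_def factors_through_def D by blast
  obtain b where b: "b \<in> hom A (Dom A n) M" "n = m \<cdot> b"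
    using n unfolding sub_class_def factors_through_def D by blast
  show ?thesis
    using that[OF nM a(1) b(1) a(2) b(2)]
      monic_factor_inverse[OF MM_monic[OF m(1)] m(2) nM(2) a(1) b(1) a(2) b(2)]
      monic_factor_inverse[OF MM_monic[OF nM(1)] nM(2) m(2) b(1) a(1) b(2) a(2)] by blast
qed

lemma preimg_class:
  assumes pb: "is_pullback A f n k l" and f: "f \<in> hom A X Y" and nM: "n \<in> MM A"
    and n: "n \<in> hom A N Y"
  shows "preimg A f (sub_class A n) = sub_class A k"
proof (rule equalityI; rule subsetI)
  note kl = is_pullbackD[OF pb f n]
  have kM: "k \<in> MM A" by (rule MM_pullback[OF pb f nM n])
  {
    fix k' assume "k' \<in> preimg A f (sub_class A n)"
    then obtain n' l' where n': "n' \<in> sub_class A n" and pb': "is_pullback A f n' k' l'"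
      by (auto simp: preimg_def)
    have n'M: "n' \<in> MM A" "Cod A n' = Y" "factors_through A n n'" "factors_through A n' n"
      using n' n by (auto simp: sub_class_def hom_def)
    then obtain N' where n'h: "n' \<in> hom A N' Y" using MM_hom by blast
    note kl' = is_pullbackD[OF pb' f n'h]
    have key: "factors_through A k2 k1"
      if pb1: "is_pullback A f n1 k1 l1" and n1: "n1 \<in> hom A N1 Y"
        and pb2: "is_pullback A f n2 k2 l2" and n2: "n2 \<in> hom A N2 Y"
        and ft: "factors_through A n2 n1" for n1 k1 l1 N1 n2 k2 l2 N2
    proof -
      note kl1 = is_pullbackD[OF pb1 f n1]
      note kl2 = is_pullbackD[OF pb2 f n2]
      obtain i where i: "i \<in> hom A N2 N1" "n2 = n1 \<cdot> i"
        using ft n1 n2 unfolding factors_through_def by (metis homD)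
      have "f \<cdot> k2 = n1 \<cdot> (i \<cdot> l2)" using kl2 assoc[OF kl2(2) i(1) n1] i by simp
      from is_pullback_lift[OF pb1 f n1 kl2(1) comp[OF kl2(2) i(1)] this]
      obtain t where "t \<in> hom A (Dom A k2) (Dom A k1)" "k1 \<cdot> t = k2" by metis
      then show ?thesis by (auto simp: factors_through_def)
    qed
    have "k' \<in> MM A" using MM_pullback[OF pb' f n'M(1) n'h] .
    moreover have "Cod A k' = Cod A k" using kl kl' by (simp add: hom_def)
    ultimately show "k' \<in> sub_class A k"
      using key[OF pb n pb' n'h] key[OF pb' n'h pb n] n'M by (auto simp: sub_class_def)
  next
    fix k' assume "k' \<in> sub_class A k"
    then obtain K' b a where k'M: "k' \<in> MM A" and k'h: "k' \<in> hom A K' X"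
      and b: "b \<in> hom A (Dom A k) K'" and a: "a \<in> hom A K' (Dom A k)"
      and kb: "k = k' \<cdot> b" and ka: "k' = k \<cdot> a"
      and ab: "a \<cdot> b = Ident A (Dom A k)" "b \<cdot> a = Ident A K'"
      by (rule sub_class_iso[OF kM kl(1)])
    have la: "l \<cdot> a \<in> hom A K' N" by (rule comp[OF a kl(2)])
    have "is_pullback A f n k' (l \<cdot> a)"
    proof (rule is_pullbackI[OF f n k'h la])
      show "f \<cdot> k' = n \<cdot> (l \<cdot> a)"
        unfolding ka assoc[OF a kl(1) f] assoc[OF a kl(2) n] by (simp add: kl(3))
    next
      fix W u v assume u: "u \<in> hom A W X" and v: "v \<in> hom A W N" and e: "f \<cdot> u = n \<cdot> v"
      obtain t where t: "t \<in> hom A W (Dom A k)" "k \<cdot> t = u" "l \<cdot> t = v"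
        using is_pullback_lift[OF pb f n u v e] by metis
      have bt: "b \<cdot> t \<in> hom A W K'" by (rule comp[OF t(1) b])
      have abt: "a \<cdot> (b \<cdot> t) = t" using assoc[OF t(1) b a] ab(1) comp_ident[OF t(1)] by simp
      have "k' \<cdot> (b \<cdot> t) = u" using assoc[OF t(1) b k'h] kb t(2) by metis
      moreover have "(l \<cdot> a) \<cdot> (b \<cdot> t) = v" using assoc[OF bt a kl(2)] abt t(3) by simp
      ultimately show "\<exists>t \<in> hom A W K'. k' \<cdot> t = u \<and> (l \<cdot> a) \<cdot> t = v" using bt by blast
    next
      fix W x y assume "x \<in> hom A W K'" "y \<in> hom A W K'" "k' \<cdot> x = k' \<cdot> y"
      then show "x = y" using monicD[OF MM_monic[OF k'M] k'h] by blast
    qed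
    moreover have "n \<in> sub_class A n"
      using nM factors_refl[OF n] by (simp add: sub_class_def)
    ultimately show "k' \<in> preimg A f (sub_class A n)" by (auto simp: preimg_def)
  }
qed

lemma preimg_Sub_belongs:
  assumes f: "f \<in> hom A X Y" and x: "x \<in> Sub A Y"
  shows "preimg A f x \<in> Sub A X \<and>
    (\<forall>V. \<forall>w \<in> hom A V X. belongs A w (preimg A f x) \<longleftrightarrow> belongs A (f \<cdot> w) x)"
proof -
  obtain n N where n: "n \<in> MM A" "n \<in> hom A N Y" "x = sub_class A n" using Sub_cases x .
  obtain P k l where pb: "is_pullback A f n k l" "k \<in> hom A P X" "l \<in> hom A P N"
    using pullback_exists[OF f n(2)] .
  have P: "Dom A k = P" using pb by (simp add: hom_def)
  have kM: "k \<in> MM A" by (rule MM_pullback[OF pb(1) f n(1,2)])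
  have e: "preimg A f x = sub_class A k" unfolding n(3) by (rule preimg_class[OF pb(1) f n(1,2)])
  have "belongs A w (sub_class A k) \<longleftrightarrow> belongs A (f \<cdot> w) x" if w: "w \<in> hom A V X" for V w
    unfolding n(3) belongs_factor[OF kM pb(2) w] belongs_factor[OF n(1,2) comp[OF w f]]
  proof
    assume "\<exists>t\<in>hom A V P. w = k \<cdot> t"
    then obtain t where t: "t \<in> hom A V P" "w = k \<cdot> t" by blast
    have "f \<cdot> w = n \<cdot> (l \<cdot> t)"
      using assoc[OF t(1) pb(2) f] assoc[OF t(1) pb(3) n(2)] t is_pullbackD(3)[OF pb(1) f n(2)] by simp
    then show "\<exists>k\<in>hom A V N. f \<cdot> w = n \<cdot> k" using comp[OF t(1) pb(3)] by blast
  next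
    assume "\<exists>k\<in>hom A V N. f \<cdot> w = n \<cdot> k"
    then obtain v where v: "v \<in> hom A V N" "f \<cdot> w = n \<cdot> v" by blast
    obtain t where "t \<in> hom A V P" "k \<cdot> t = w"
      using is_pullback_lift[OF pb(1) f n(2) w v] P by metis
    then show "\<exists>t\<in>hom A V P. w = k \<cdot> t" by blast
  qed
  then show ?thesis unfolding e using sub_classI[OF kM pb(2)] by blast
qed

lemma preimg_Sub: "f \<in> hom A X Y \<Longrightarrow> x \<in> Sub A Y \<Longrightarrow> preimg A f x \<in> Sub A X"
  using preimg_Sub_belongs by blast

lemma belongs_preimg:
  "f \<in> hom A X Y \<Longrightarrow> x \<in> Sub A Y \<Longrightarrow> w \<in> hom A V X \<Longrightarrow>
    belongs A w (preimg A f x) \<longleftrightarrow> belongs A (f \<cdot> w) x"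
  using preimg_Sub_belongs by blast

lemma preimg_mono:
  assumes f: "f \<in> hom A X Y" and xy: "x \<in> Sub A Y" "y \<in> Sub A Y" "x \<sqsubseteq>\<^bsub>SubO A Y\<^esub> y"
  shows "preimg A f x \<sqsubseteq>\<^bsub>SubO A X\<^esub> preimg A f y"
  unfolding le_iff[OF preimg_Sub[OF f xy(1)] preimg_Sub[OF f xy(2)]]
proof (intro allI ballI)
  fix V w assume w: "w \<in> hom A V X"
  show "belongs A w (preimg A f x) \<longrightarrow> belongs A w (preimg A f y)"
    unfolding belongs_preimg[OF f xy(1) w] belongs_preimg[OF f xy(2) w]
    using xy(3) comp[OF w f] unfolding le_iff[OF xy(1,2)] by blast
qed

lemma preimg_comp:
  assumes f: "f \<in> hom A X Y" and g: "g \<in> hom A Y Z" and x: "x \<in> Sub A Z"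
  shows "preimg A (g \<cdot> f) x = preimg A f (preimg A g x)"
proof (rule Sub_eqI)
  show "preimg A (g \<cdot> f) x \<in> Sub A X" using preimg_Sub comp f g x by blast
  show "preimg A f (preimg A g x) \<in> Sub A X" using preimg_Sub f g x by blast
  fix V w assume w: "w \<in> hom A V X"
  show "belongs A w (preimg A (g \<cdot> f) x) \<longleftrightarrow> belongs A w (preimg A f (preimg A g x))"
    using belongs_preimg[OF comp[OF f g] x w] belongs_preimg[OF f preimg_Sub[OF g x] w]
      belongs_preimg[OF g x comp[OF w f]] assoc[OF w f g] by simp
qed

lemma preimg_Ident:
  assumes "x \<in> Sub A X"
  shows "preimg A (Ident A X) x = x"
proof -
  have X: "X \<in> Obj A" using assms Sub_cases Obj_hom by metis
  show ?thesis
  proof (rule Sub_eqI[OF preimg_Sub[OF ident[OF X] assms] assms])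
    fix V w assume w: "w \<in> hom A V X"
    show "belongs A w (preimg A (Ident A X) x) \<longleftrightarrow> belongs A w x"
      using belongs_preimg[OF ident[OF X] assms w] comp_ident[OF w] by simp
  qed
qed

lemma M_part_class:
  assumes e: "e \<in> EE A" "e \<in> hom A X M" and m: "m \<in> MM A" "m \<in> hom A M Y"
  shows "M_part A (m \<cdot> e) = sub_class A m"
proof (rule equalityI; rule subsetI)
  {
    fix n assume "n \<in> M_part A (m \<cdot> e)"
    then obtain e' where n: "n \<in> MM A" "e' \<in> EE A" "Cod A e' = Dom A n" "m \<cdot> e = n \<cdot> e'"
      by (auto simp: M_part_def)
    have h: "n \<in> hom A (Dom A n) (Cod A n)" "e' \<in> hom A (Dom A e') (Dom A n)"
      using MM_hom EE_hom n by metis+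
    have "m \<cdot> e \<in> hom A X Y" "n \<cdot> e' \<in> hom A (Dom A e') (Cod A n)" using comp e m h by blast+
    then have dc: "Dom A e' = X" "Cod A n = Y" using n by (auto simp: hom_def)
    note h = h[unfolded dc]
    have D: "Dom A m = M" "Cod A m = Y" using m(2) by (simp_all add: hom_def)
    obtain d where d: "d \<in> hom A M (Dom A n)" "n \<cdot> d = m"
      using diagonal_fill[OF e(1) n(1) e(2) h(1) h(2) m(2)] n(4) by metis
    obtain d' where d': "d' \<in> hom A (Dom A n) M" "m \<cdot> d' = n"
      using diagonal_fill[OF n(2) m(1) h(2) m(2) e(2) h(1)] n(4) by metis
    have "factors_through A m n" unfolding factors_through_def D using d by blast
    moreover have "factors_through A n m" unfolding factors_through_def D using d' by blast
    ultimately show "n \<in> sub_class A m" using n(1) dc D by (simp add: sub_class_def)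
  next
    fix n assume n: "n \<in> sub_class A m"
    obtain N a b where nM: "n \<in> MM A" and nh: "n \<in> hom A N Y" and a: "a \<in> hom A M N"
      and b: "b \<in> hom A N M" and ma: "m = n \<cdot> a" and nb: "n = m \<cdot> b"
      and ab: "b \<cdot> a = Ident A M" "a \<cdot> b = Ident A N"
      using sub_class_iso[OF m n] .
    have "a \<in> EE A" using isoI[OF a b ab] iso_EE by blast
    then have "a \<cdot> e \<in> EE A" using EE_comp[OF e(1)] e(2) a by (simp add: hom_def)
    moreover have "m \<cdot> e = n \<cdot> (a \<cdot> e)" unfolding ma by (rule assoc[OF e(2) a nh, symmetric])
    moreover have "Cod A (a \<cdot> e) = Dom A n" using comp[OF e(2) a] nh by (simp add: hom_def)
    ultimately show "n \<in> M_part A (m \<cdot> e)" using nM unfolding M_part_def by blast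
  }
qed

lemma img_class:
  assumes f: "f \<in> hom A X Y" and m: "m \<in> MM A" "m \<in> hom A M X" and fm: "f \<cdot> m \<in> MM A"
  shows "img A f (sub_class A m) = sub_class A (f \<cdot> m)"
proof -
  have "M_part A (f \<cdot> n) = sub_class A (f \<cdot> m)" if n: "n \<in> sub_class A m" for n
  proof -
    obtain N a b where nM: "n \<in> MM A" and nh: "n \<in> hom A N X" and a: "a \<in> hom A M N"
      and b: "b \<in> hom A N M" and ma: "m = n \<cdot> a" and nb: "n = m \<cdot> b"
      and ab: "b \<cdot> a = Ident A M" "a \<cdot> b = Ident A N"
      using sub_class_iso[OF m n] .
    have "b \<in> EE A" using isoI[OF b a ab(2,1)] iso_EE by blast
    then have "M_part A ((f \<cdot> m) \<cdot> b) = sub_class A (f \<cdot> m)"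
      by (rule M_part_class[OF _ b fm comp[OF m(2) f]])
    then show ?thesis unfolding nb using assoc[OF b m(2) f] by simp
  qed
  moreover have "m \<in> sub_class A m" using m factors_refl by (simp add: sub_class_def)
  ultimately show ?thesis unfolding img_def by blast
qed

lemma initial_exists: obtains I where "initial A I"
proof -
  obtain S c where "is_coproduct A {} (\<lambda>_. undefined) S c"
    using finite_coproducts unfolding has_finite_coproducts_def by fastforce
  then have "initial A S" by (auto simp: is_coproduct_def initial_def)
  then show ?thesis using that by blast
qed

lemma initial_maps_eq:
  assumes "initial A I" "a \<in> hom A I X" "b \<in> hom A I X"
  shows "a = b"
  using assms Obj_hom unfolding initial_def by blast

end

section \<open>The lattice of admissible subobjects\<close>

context pnbd_context
begin

lemma Sub_Obj: "x \<in> Sub A X \<Longrightarrow> X \<in> Obj A"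
  using Sub_cases Obj_hom by blast

lemma Sub_refl: "x \<in> Sub A X \<Longrightarrow> x \<sqsubseteq>\<^bsub>SubO A X\<^esub> x"
  by (simp add: le_iff)

lemma Sub_trans:
  "x \<sqsubseteq>\<^bsub>SubO A X\<^esub> y \<Longrightarrow> y \<sqsubseteq>\<^bsub>SubO A X\<^esub> z \<Longrightarrow> x \<in> Sub A X \<Longrightarrow> y \<in> Sub A X \<Longrightarrow> z \<in> Sub A X \<Longrightarrow>
    x \<sqsubseteq>\<^bsub>SubO A X\<^esub> z"
  by (simp add: le_iff)

lemma Sub_antisym:
  "x \<sqsubseteq>\<^bsub>SubO A X\<^esub> y \<Longrightarrow> y \<sqsubseteq>\<^bsub>SubO A X\<^esub> x \<Longrightarrow> x \<in> Sub A X \<Longrightarrow> y \<in> Sub A X \<Longrightarrow> x = y"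
  by (rule Sub_eqI) (auto simp: le_iff)

lemma belongs_le:
  assumes "w \<in> hom A V X" "belongs A w x" "x \<sqsubseteq>\<^bsub>SubO A X\<^esub> y" "x \<in> Sub A X" "y \<in> Sub A X"
  shows "belongs A w y"
  using assms le_iff by blast

text \<open>
  The smallest subobject with the element \<open>w\<close> is the image of \<open>w\<close>. It translates statements about
  generalized elements into statements about infima in the lattice of subobjects.
\<close>
lemma least_containing:
  assumes "w \<in> hom A V X"
  obtains z where "z \<in> Sub A X" "belongs A w z"
    "\<forall>x \<in> Sub A X. belongs A w x \<longrightarrow> z \<sqsubseteq>\<^bsub>SubO A X\<^esub> x"
proof -
  obtain e m where e: "e \<in> EE A" "e \<in> hom A V (Dom A m)" and m: "m \<in> MM A" "m \<in> hom A (Dom A m) X"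
    and w: "w = m \<cdot> e" using factorize[OF assms] by metis
  show ?thesis
  proof (rule that[of "sub_class A m"])
    show "sub_class A m \<in> Sub A X" using sub_classI m .
    show "belongs A w (sub_class A m)" using belongs_factor[OF m assms] e w by blast
    show "\<forall>x \<in> Sub A X. belongs A w x \<longrightarrow> sub_class A m \<sqsubseteq>\<^bsub>SubO A X\<^esub> x"
    proof (intro ballI impI)
      fix x assume x: "x \<in> Sub A X" "belongs A w x"
      obtain n N where n: "n \<in> MM A" "n \<in> hom A N X" "x = sub_class A n" using Sub_cases x(1) .
      obtain k where k: "k \<in> hom A V N" "w = n \<cdot> k"
        using x(2) belongs_factor[OF n(1,2) assms] n(3) by blast
      obtain d where d: "d \<in> hom A (Dom A m) N" "n \<cdot> d = m"
        using diagonal_fill[OF e(1) n(1) e(2) n(2) k(1) m(2)] k w by metis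
      have "factors_through A m n"
        unfolding factors_through_def using d n(2) by (auto simp: hom_def)
      then show "sub_class A m \<sqsubseteq>\<^bsub>SubO A X\<^esub> x" using le_class[OF m n(1,2)] n(3) by blast
    qed
  qed
qed

lemma sub_bot_rep:
  assumes X: "X \<in> Obj A"
  obtains I e m M where "initial A I" "e \<in> EE A" "e \<in> hom A I M" "m \<in> MM A" "m \<in> hom A M X"
    "sub_bot A X = sub_class A m"
proof -
  obtain I where I: "initial A I" by (rule initial_exists)
  then obtain i where i: "i \<in> hom A I X" using X unfolding initial_def by blast
  obtain e m where em: "e \<in> EE A" "m \<in> MM A" "e \<in> hom A I (Dom A m)" "m \<in> hom A (Dom A m) X"
    "i = m \<cdot> e" using factorize[OF i] by metis
  have "M_part A j = sub_class A m" if J: "initial A J" and j: "j \<in> hom A J X" for J j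
  proof -
    obtain u where u: "u \<in> hom A J I" using I J unfolding initial_def by blast
    obtain v where v: "v \<in> hom A I J" using I J unfolding initial_def by blast
    have "v \<cdot> u = Ident A J"
      using initial_maps_eq[OF J comp[OF u v]] ident J unfolding initial_def by blast
    moreover have "u \<cdot> v = Ident A I"
      using initial_maps_eq[OF I comp[OF v u]] ident I unfolding initial_def by blast
    ultimately have "u \<in> EE A" using isoI[OF u v] iso_EE by blast
    then have eu: "e \<cdot> u \<in> EE A" using EE_comp em u by (simp add: hom_def)
    have "j = i \<cdot> u" using initial_maps_eq[OF J j comp[OF u i]] .
    also have "\<dots> = m \<cdot> (e \<cdot> u)" unfolding em(5) by (rule assoc[OF u em(3,4), symmetric])
    finally show ?thesis using M_part_class[OF eu comp[OF u em(3)] em(2,4)] by simp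
  qed
  then have "sub_bot A X = sub_class A m" unfolding sub_bot_def using I i by blast
  then show ?thesis using that[OF I em(1,3,2,4)] by blast
qed

lemma sub_bot_Sub: "X \<in> Obj A \<Longrightarrow> sub_bot A X \<in> Sub A X"
  using sub_bot_rep sub_classI by metis

lemma sub_bot_least:
  assumes x: "x \<in> Sub A X"
  shows "sub_bot A X \<sqsubseteq>\<^bsub>SubO A X\<^esub> x"
proof -
  obtain I e m M where I: "initial A I" and e: "e \<in> EE A" "e \<in> hom A I M"
    and m: "m \<in> MM A" "m \<in> hom A M X" and b: "sub_bot A X = sub_class A m"
    using sub_bot_rep[OF Sub_Obj[OF x]] .
  obtain n N where n: "n \<in> MM A" "n \<in> hom A N X" "x = sub_class A n" using Sub_cases x .
  obtain j where j: "j \<in> hom A I N" using I n(2) Obj_hom unfolding initial_def by blast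
  have "n \<cdot> j = m \<cdot> e" using initial_maps_eq[OF I comp[OF j n(2)] comp[OF e(2) m(2)]] .
  then obtain d where d: "d \<in> hom A M N" "n \<cdot> d = m"
    using diagonal_fill[OF e(1) n(1) e(2) n(2) j m(2)] by metis
  have "factors_through A m n"
    unfolding factors_through_def using d n(2) m(2) by (auto simp: hom_def)
  then show ?thesis using le_class[OF m n(1,2)] n(3) b by simp
qed

text \<open>
  The smallest subobject is a quotient of the initial object, so two morphisms out of it with the
  same codomain coincide.
\<close>
lemma belongs_sub_bot_eq:
  assumes w: "w \<in> hom A V X" and b: "belongs A w (sub_bot A X)"
    and f: "f \<in> hom A X Y" and g: "g \<in> hom A X Y"
  shows "f \<cdot> w = g \<cdot> w"
proof -
  have "X \<in> Obj A" using Obj_hom w by blast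
  then obtain I e m M where I: "initial A I" and e: "e \<in> EE A" "e \<in> hom A I M"
    and m: "m \<in> MM A" "m \<in> hom A M X" and bm: "sub_bot A X = sub_class A m"
    by (rule sub_bot_rep)
  obtain k where k: "k \<in> hom A V M" "w = m \<cdot> k"
    using b belongs_factor[OF m w] unfolding bm by blast
  have "(f \<cdot> m) \<cdot> e = (g \<cdot> m) \<cdot> e"
    by (rule initial_maps_eq[OF I comp[OF e(2) comp[OF m(2) f]] comp[OF e(2) comp[OF m(2) g]]])
  then have "f \<cdot> m = g \<cdot> m"
    by (rule epicD[OF EE_epic[OF e(1)] e(2) comp[OF m(2) f] comp[OF m(2) g]])
  then show ?thesis unfolding k(2) assoc[OF k(1) m(2) f] assoc[OF k(1) m(2) g] by simp
qed

lemma disjoint_iff: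
  assumes x: "x \<in> Sub A X" and y: "y \<in> Sub A X"
  shows "x \<sqinter>\<^bsub>SubO A X\<^esub> y = sub_bot A X \<longleftrightarrow>
    (\<forall>V. \<forall>w \<in> hom A V X. belongs A w x \<longrightarrow> belongs A w y \<longrightarrow> belongs A w (sub_bot A X))"
    (is "?L \<longleftrightarrow> ?R")
proof -
  interpret L: complete_lattice "SubO A X" by (rule sub_complete[OF Sub_Obj[OF x]])
  have b: "sub_bot A X \<in> Sub A X" by (rule sub_bot_Sub[OF Sub_Obj[OF x]])
  have xy: "x \<sqinter>\<^bsub>SubO A X\<^esub> y \<in> Sub A X" using L.meet_closed x y .
  show ?thesis
  proof
    assume l: ?L
    show ?R
    proof (intro allI ballI impI)
      fix V w assume w: "w \<in> hom A V X" "belongs A w x" "belongs A w y"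
      obtain z where z: "z \<in> Sub A X" "belongs A w z"
        "\<forall>x \<in> Sub A X. belongs A w x \<longrightarrow> z \<sqsubseteq>\<^bsub>SubO A X\<^esub> x"
        using least_containing[OF w(1)] .
      have "z \<sqsubseteq>\<^bsub>SubO A X\<^esub> sub_bot A X"
        using L.meet_le[OF bspec[OF z(3) x, rule_format, OF w(2)] bspec[OF z(3) y, rule_format, OF w(3)]
            x y z(1)] l by simp
      then show "belongs A w (sub_bot A X)" by (rule belongs_le[OF w(1) z(2) _ z(1) b])
    qed
  next
    assume r: ?R
    have "x \<sqinter>\<^bsub>SubO A X\<^esub> y \<sqsubseteq>\<^bsub>SubO A X\<^esub> sub_bot A X" unfolding le_iff[OF xy b]
    proof (intro allI ballI impI)
      fix V w assume w: "w \<in> hom A V X" "belongs A w (x \<sqinter>\<^bsub>SubO A X\<^esub> y)"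
      show "belongs A w (sub_bot A X)"
        by (rule r[rule_format, OF w(1) belongs_le[OF w L.meet_left[OF x y] xy x]
              belongs_le[OF w L.meet_right[OF x y] xy y]])
    qed
    then show ?L by (rule Sub_antisym[OF _ sub_bot_least[OF xy] xy b])
  qed
qed

section \<open>Preneighbourhood systems\<close>

lemma pnbd_systemD:
  assumes "pnbd_system A X \<mu>" "m \<in> Sub A X" "p \<in> \<mu> m"
  shows "p \<in> Sub A X" "m \<sqsubseteq>\<^bsub>SubO A X\<^esub> p"
proof -
  have "is_filter A X (\<mu> m)" using assms by (simp add: pnbd_system_def)
  then have "\<mu> m \<subseteq> Sub A X" unfolding is_filter_def by (elim conjE)
  then show "p \<in> Sub A X" using assms(3) by (rule subsetD)
  show "m \<sqsubseteq>\<^bsub>SubO A X\<^esub> p" using assms by (simp add: pnbd_system_def)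
qed

lemma pnbd_system_antimono:
  "pnbd_system A X \<mu> \<Longrightarrow> m \<in> Sub A X \<Longrightarrow> n \<in> Sub A X \<Longrightarrow> m \<sqsubseteq>\<^bsub>SubO A X\<^esub> n \<Longrightarrow> \<mu> n \<subseteq> \<mu> m"
  by (simp add: pnbd_system_def)

lemma filter_mono:
  "is_filter A X F \<Longrightarrow> p \<in> F \<Longrightarrow> q \<in> Sub A X \<Longrightarrow> p \<sqsubseteq>\<^bsub>SubO A X\<^esub> q \<Longrightarrow> q \<in> F"
  unfolding is_filter_def by blast

lemma filter_Inf: "is_filter A X F \<Longrightarrow> S \<subseteq> F \<Longrightarrow> finite S \<Longrightarrow> \<Sqinter>\<^bsub>SubO A X\<^esub> S \<in> F"
  unfolding is_filter_def by blast

text \<open>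
  Only the smallest subobject is far from itself, and its closure is the supremum of the empty set.
  Every other \<open>p\<close> takes part in the supremum that defines its closure, so \<open>p\<close> is closed as soon as
  it bounds the remaining members, which are neither strictly above \<open>p\<close> nor far from it.
\<close>
lemma closed_subs_iff:
  assumes X: "X \<in> Obj A" and \<mu>: "pnbd_system A X \<mu>" and p: "p \<in> Sub A X"
  shows "p \<in> closed_subs A (X, \<mu>) \<longleftrightarrow>
    (\<forall>y \<in> Sub A X. y \<sqsubseteq>\<^bsub>SubO A X\<^esub> p \<or> p \<sqsubseteq>\<^bsub>SubO A X\<^esub> y \<or> (\<exists>u \<in> \<mu> y. u \<sqinter>\<^bsub>SubO A X\<^esub> p = sub_bot A X))"
    (is "_ \<longleftrightarrow> ?R")
proof -
  interpret L: complete_lattice "SubO A X" by (rule sub_complete[OF X])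
  let ?C = "{x \<in> Sub A X. \<not> p \<sqsubset>\<^bsub>SubO A X\<^esub> x \<and> x \<notin> Far A (X, \<mu>) p}"
  have C: "?C \<subseteq> Sub A X" by blast
  have b: "sub_bot A X \<in> Sub A X" by (rule sub_bot_Sub[OF X])
  have "p \<in> closed_subs A (X, \<mu>) \<longleftrightarrow> \<Squnion>\<^bsub>SubO A X\<^esub> ?C = p"
    using p by (simp add: closed_subs_def cl_def)
  also have "\<dots> \<longleftrightarrow> ?R"
  proof
    assume s: "\<Squnion>\<^bsub>SubO A X\<^esub> ?C = p"
    show ?R
    proof
      fix y assume y: "y \<in> Sub A X"
      show "y \<sqsubseteq>\<^bsub>SubO A X\<^esub> p \<or> p \<sqsubseteq>\<^bsub>SubO A X\<^esub> y \<or> (\<exists>u \<in> \<mu> y. u \<sqinter>\<^bsub>SubO A X\<^esub> p = sub_bot A X)"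
      proof (cases "y \<in> ?C")
        case True
        then have "y \<sqsubseteq>\<^bsub>SubO A X\<^esub> p" using L.sup_upper[OF C True] s by simp
        then show ?thesis by blast
      next
        case False
        then show ?thesis using y by (auto simp: L.lless_eq Far_def)
      qed
    qed
  next
    assume r: ?R
    show "\<Squnion>\<^bsub>SubO A X\<^esub> ?C = p"
    proof (rule Sub_antisym[OF _ _ L.sup_closed[OF C] p])
      show "\<Squnion>\<^bsub>SubO A X\<^esub> ?C \<sqsubseteq>\<^bsub>SubO A X\<^esub> p"
      proof (rule L.sup_least[OF C p])
        fix y assume y: "y \<in> ?C"
        then show "y \<sqsubseteq>\<^bsub>SubO A X\<^esub> p"
          using r Sub_refl[OF p] by (auto simp: L.lless_eq Far_def)
      qed
      show "p \<sqsubseteq>\<^bsub>SubO A X\<^esub> \<Squnion>\<^bsub>SubO A X\<^esub> ?C"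
      proof (cases "p = sub_bot A X")
        case True
        then show ?thesis using sub_bot_least[OF L.sup_closed[OF C]] by simp
      next
        case False
        have "p \<notin> Far A (X, \<mu>) p"
        proof
          assume "p \<in> Far A (X, \<mu>) p"
          then obtain u where u: "u \<in> \<mu> p" "u \<sqinter>\<^bsub>SubO A X\<^esub> p = sub_bot A X" by (auto simp: Far_def)
          note us = pnbd_systemD[OF \<mu> p u(1)]
          have "p \<sqsubseteq>\<^bsub>SubO A X\<^esub> sub_bot A X"
            using L.meet_le[OF us(2) Sub_refl[OF p] us(1) p p] u(2) by simp
          then show False using Sub_antisym[OF _ sub_bot_least[OF p] p b] False by blast
        qed
        then have "p \<in> ?C" using p by (auto simp: L.lless_eq)
        then show ?thesis by (rule L.sup_upper[OF C])
      qed
    qed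
  qed
  finally show ?thesis .
qed

end

definition discrete_pnbd :: "('o, 'a) fact_category \<Rightarrow> 'o \<Rightarrow> 'a pnbd" where
  "discrete_pnbd A X m = {p \<in> Sub A X. m \<sqsubseteq>\<^bsub>SubO A X\<^esub> p}"

context pnbd_context
begin

lemma discrete_space:
  assumes X: "X \<in> Obj A"
  shows "pnbd_space A (X, discrete_pnbd A X)"
proof -
  interpret L: complete_lattice "SubO A X" by (rule sub_complete[OF X])
  have "is_filter A X (discrete_pnbd A X m)" if m: "m \<in> Sub A X" for m
    unfolding is_filter_def discrete_pnbd_def
  proof (intro conjI ballI allI impI)
    fix p q assume "p \<in> {p \<in> Sub A X. m \<sqsubseteq>\<^bsub>SubO A X\<^esub> p}" "q \<in> Sub A X" "p \<sqsubseteq>\<^bsub>SubO A X\<^esub> q"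
    then show "q \<in> {p \<in> Sub A X. m \<sqsubseteq>\<^bsub>SubO A X\<^esub> p}" using Sub_trans[of X m p q] m by blast
  next
    fix S assume S: "S \<subseteq> {p \<in> Sub A X. m \<sqsubseteq>\<^bsub>SubO A X\<^esub> p}"
    then have S': "S \<subseteq> Sub A X" by blast
    show "\<Sqinter>\<^bsub>SubO A X\<^esub> S \<in> {p \<in> Sub A X. m \<sqsubseteq>\<^bsub>SubO A X\<^esub> p}"
      using L.inf_closed[OF S'] L.inf_greatest[OF S' m] S by blast
  qed blast
  then show ?thesis
    using X sub_bot_least sub_bot_Sub[OF X] Sub_trans
    by (auto simp: pnbd_space_def pnbd_system_def discrete_pnbd_def)
qed

lemma pnbd_morD:
  assumes "pnbd_mor A (X, \<mu>) (Y, \<phi>) f"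
  shows "f \<in> hom A X Y" "pnbd_space A (X, \<mu>)" "pnbd_space A (Y, \<phi>)"
    "X \<in> Obj A" "Y \<in> Obj A" "pnbd_system A X \<mu>" "pnbd_system A Y \<phi>"
    "u \<in> Sub A Y \<Longrightarrow> p \<in> \<phi> u \<Longrightarrow> preimg A f p \<in> \<mu> (preimg A f u)"
  using assms by (auto simp: pnbd_mor_def pnbd_space_def)

text \<open>
  Discrete spaces turn universal properties among spaces into properties of the underlying
  category.
\<close>
lemma discrete_mor:
  assumes f: "f \<in> hom A X Y" and Y: "pnbd_space A (Y, \<phi>)"
  shows "pnbd_mor A (X, discrete_pnbd A X) (Y, \<phi>) f"
proof -
  have X: "X \<in> Obj A" using Obj_hom f by blast
  have \<phi>: "pnbd_system A Y \<phi>" using Y by (simp add: pnbd_space_def)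
  have "preimg A f p \<in> discrete_pnbd A X (preimg A f u)" if u: "u \<in> Sub A Y" and p: "p \<in> \<phi> u" for u p
    using preimg_mono[OF f u pnbd_systemD[OF \<phi> u p]] preimg_Sub[OF f pnbd_systemD(1)[OF \<phi> u p]]
    by (simp add: discrete_pnbd_def)
  then show ?thesis using discrete_space[OF X] Y f by (simp add: pnbd_mor_def)
qed

lemma pnbd_mor_comp:
  assumes f: "pnbd_mor A (X, \<mu>) (Y, \<phi>) f" and g: "pnbd_mor A (Y, \<phi>) (Z, \<psi>) g"
  shows "pnbd_mor A (X, \<mu>) (Z, \<psi>) (g \<cdot> f)"
proof -
  note F = pnbd_morD[OF f] and G = pnbd_morD[OF g]
  have "preimg A (g \<cdot> f) p \<in> \<mu> (preimg A (g \<cdot> f) u)" if u: "u \<in> Sub A Z" and p: "p \<in> \<psi> u" for u p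
    unfolding preimg_comp[OF F(1) G(1) u] preimg_comp[OF F(1) G(1) pnbd_systemD(1)[OF G(7) u p]]
    by (rule F(8)[OF preimg_Sub[OF G(1) u] G(8)[OF u p]])
  then show ?thesis using comp[OF F(1) G(1)] F(2) G(3) by (simp add: pnbd_mor_def)
qed

text \<open>
  The intersection of all systems that make both projections morphisms is again such a system; the
  family is not empty because it contains the discrete system.
\<close>
lemma pnbd_pullback_exists:
  assumes X: "pnbd_space A (X, \<mu>)" and Y: "pnbd_space A (Y, \<phi>)"
    and pb: "is_pullback A f g p q" and p: "p \<in> hom A P X" and q: "q \<in> hom A P Y"
  obtains \<pi> where "pnbd_pullback A (X, \<mu>) (Y, \<phi>) f g (P, \<pi>) p q"
proof -
  define good where "good = {\<pi>. pnbd_mor A (P, \<pi>) (X, \<mu>) p \<and> pnbd_mor A (P, \<pi>) (Y, \<phi>) q}"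
  define \<pi>0 where "\<pi>0 m = (\<Inter>\<pi> \<in> good. \<pi> m)" for m
  have P: "P \<in> Obj A" using Obj_hom p by blast
  have dg: "discrete_pnbd A P \<in> good"
    using discrete_mor[OF p X] discrete_mor[OF q Y] by (simp add: good_def)
  have sys: "pnbd_system A P \<pi>" if "\<pi> \<in> good" for \<pi>
    using that pnbd_morD(6) unfolding good_def by blast
  have flt: "is_filter A P (\<pi> m)" if "\<pi> \<in> good" "m \<in> Sub A P" for \<pi> m
    using sys[OF that(1)] that(2) by (simp add: pnbd_system_def)
  have "pnbd_system A P \<pi>0"
    unfolding pnbd_system_def
  proof (intro conjI ballI impI)
    fix m assume m: "m \<in> Sub A P"
    have d: "\<pi>0 m \<subseteq> discrete_pnbd A P m" using dg by (auto simp: \<pi>0_def)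
    show "is_filter A P (\<pi>0 m)"
      unfolding is_filter_def
    proof (intro conjI ballI allI impI)
      show "\<pi>0 m \<subseteq> Sub A P" using d by (auto simp: discrete_pnbd_def)
    next
      fix r s assume "r \<in> \<pi>0 m" "s \<in> Sub A P" "r \<sqsubseteq>\<^bsub>SubO A P\<^esub> s"
      then show "s \<in> \<pi>0 m" using filter_mono[OF flt[OF _ m]] unfolding \<pi>0_def by blast
    next
      fix S assume "S \<subseteq> \<pi>0 m" "finite S"
      then show "\<Sqinter>\<^bsub>SubO A P\<^esub> S \<in> \<pi>0 m" using filter_Inf[OF flt[OF _ m]] unfolding \<pi>0_def by blast
    qed
    { fix n assume n: "n \<in> Sub A P" "m \<sqsubseteq>\<^bsub>SubO A P\<^esub> n"
      have "\<pi> n \<subseteq> \<pi> m" if "\<pi> \<in> good" for \<pi>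
        by (rule pnbd_system_antimono[OF sys[OF that] m n])
      then show "\<pi>0 n \<subseteq> \<pi>0 m" unfolding \<pi>0_def by blast }
    { fix r assume "r \<in> \<pi>0 m"
      then show "m \<sqsubseteq>\<^bsub>SubO A P\<^esub> r" using d by (auto simp: discrete_pnbd_def) }
  next
    have "\<pi> (sub_bot A P) = Sub A P" if "\<pi> \<in> good" for \<pi>
      using sys[OF that] by (simp add: pnbd_system_def)
    then show "\<pi>0 (sub_bot A P) = Sub A P" using dg unfolding \<pi>0_def by auto
  qed
  then have sp: "pnbd_space A (P, \<pi>0)" using P by (simp add: pnbd_space_def)
  have "pnbd_mor A (P, \<pi>0) (X, \<mu>) p" "pnbd_mor A (P, \<pi>0) (Y, \<phi>) q"
    using sp X Y p q by (auto simp: pnbd_mor_def \<pi>0_def good_def)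
  then have "pnbd_pullback A (X, \<mu>) (Y, \<phi>) f g (P, \<pi>0) p q"
    using pb by (auto simp: pnbd_pullback_def \<pi>0_def good_def)
  then show ?thesis by (rule that)
qed

end

text \<open>
  The transport of \<open>\<mu>\<close> along \<open>i : X \<rightarrow> Y\<close>, a preneighbourhood system if \<open>i\<close> is an isomorphism.
  It serves as an upper bound for the systems that are characterized by minimality.
\<close>
definition push_pnbd :: "('o, 'a) fact_category \<Rightarrow> 'o \<Rightarrow> 'a \<Rightarrow> 'a pnbd \<Rightarrow> 'a pnbd" where
  "push_pnbd A Y i \<mu> m = {p \<in> Sub A Y. preimg A i p \<in> \<mu> (preimg A i m)}"

context pnbd_context
begin

lemma preimg_inverse:
  assumes "i \<in> hom A X Y" "j \<in> hom A Y X" "j \<cdot> i = Ident A X" "x \<in> Sub A X"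
  shows "preimg A i (preimg A j x) = x"
  using preimg_comp[OF assms(1,2,4)] preimg_Ident[OF assms(4)] assms(3) by simp

lemma preimg_sub_bot:
  assumes i: "i \<in> hom A X Y" and j: "j \<in> hom A Y X" and ji: "j \<cdot> i = Ident A X"
  shows "preimg A i (sub_bot A Y) = sub_bot A X"
proof -
  have X: "sub_bot A X \<in> Sub A X" and Y: "sub_bot A Y \<in> Sub A Y"
    using sub_bot_Sub Obj_hom i by blast+
  have "preimg A i (sub_bot A Y) \<sqsubseteq>\<^bsub>SubO A X\<^esub> preimg A i (preimg A j (sub_bot A X))"
    by (rule preimg_mono[OF i Y preimg_Sub[OF j X] sub_bot_least[OF preimg_Sub[OF j X]]])
  then show ?thesis
    using Sub_antisym[OF _ sub_bot_least[OF preimg_Sub[OF i Y]] preimg_Sub[OF i Y] X]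
      preimg_inverse[OF i j ji X] by simp
qed

lemma push_space:
  assumes i: "i \<in> hom A X Y" and j: "j \<in> hom A Y X" and ji: "j \<cdot> i = Ident A X"
    and ij: "i \<cdot> j = Ident A Y" and X: "pnbd_space A (X, \<mu>)"
  shows "pnbd_space A (Y, push_pnbd A Y i \<mu>)"
proof -
  have YO: "Y \<in> Obj A" using Obj_hom i by blast
  have \<mu>: "pnbd_system A X \<mu>" using X by (simp add: pnbd_space_def)
  interpret L: complete_lattice "SubO A Y" by (rule sub_complete[OF YO])
  interpret LX: complete_lattice "SubO A X" by (rule sub_complete) (use Obj_hom i in blast)
  note pS = preimg_Sub[OF i]
  have flt: "is_filter A X (\<mu> (preimg A i m))" if "m \<in> Sub A Y" for m
    using \<mu> pS[OF that] by (simp add: pnbd_system_def)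
  have "pnbd_system A Y (push_pnbd A Y i \<mu>)"
    unfolding pnbd_system_def
  proof (intro conjI ballI impI)
    fix m assume m: "m \<in> Sub A Y"
    show "is_filter A Y (push_pnbd A Y i \<mu> m)"
      unfolding is_filter_def
    proof (intro conjI ballI allI impI)
      show "push_pnbd A Y i \<mu> m \<subseteq> Sub A Y" by (auto simp: push_pnbd_def)
    next
      fix p q assume p: "p \<in> push_pnbd A Y i \<mu> m" and q: "q \<in> Sub A Y" and le: "p \<sqsubseteq>\<^bsub>SubO A Y\<^esub> q"
      have "p \<in> Sub A Y" "preimg A i p \<in> \<mu> (preimg A i m)" using p by (auto simp: push_pnbd_def)
      then show "q \<in> push_pnbd A Y i \<mu> m"
        using filter_mono[OF flt[OF m] _ pS[OF q] preimg_mono[OF i _ q le]] q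
        by (simp add: push_pnbd_def)
    next
      fix S assume S: "S \<subseteq> push_pnbd A Y i \<mu> m" and fin: "finite S"
      have SY: "S \<subseteq> Sub A Y" using S by (auto simp: push_pnbd_def)
      have SX: "preimg A i ` S \<subseteq> Sub A X" by (rule image_subsetI) (rule pS[OF subsetD[OF SY]])
      let ?I = "\<Sqinter>\<^bsub>SubO A X\<^esub> (preimg A i ` S)"
      have IX: "?I \<in> Sub A X" by (rule LX.inf_closed[OF SX])
      have IY: "\<Sqinter>\<^bsub>SubO A Y\<^esub> S \<in> Sub A Y" by (rule L.inf_closed[OF SY])
      have "?I \<in> \<mu> (preimg A i m)"
        by (rule filter_Inf[OF flt[OF m] _ finite_imageI[OF fin]], rule image_subsetI)
          (use S in \<open>simp add: push_pnbd_def subset_eq\<close>)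
      moreover have "?I \<sqsubseteq>\<^bsub>SubO A X\<^esub> preimg A i (\<Sqinter>\<^bsub>SubO A Y\<^esub> S)"
        unfolding le_iff[OF IX pS[OF IY]]
      proof (intro allI ballI impI)
        fix V w assume w: "w \<in> hom A V X" and wI: "belongs A w ?I"
        have iw: "i \<cdot> w \<in> hom A V Y" by (rule comp[OF w i])
        have in_all: "belongs A (i \<cdot> w) s" if s: "s \<in> S" for s
        proof -
          have sY: "s \<in> Sub A Y" using s SY by blast
          have "belongs A w (preimg A i s)"
            by (rule belongs_le[OF w wI LX.inf_lower[OF SX imageI[OF s]] IX pS[OF sY]])
          then show ?thesis using belongs_preimg[OF i sY w] by simp
        qed
        obtain z where z: "z \<in> Sub A Y" "belongs A (i \<cdot> w) z"
          "\<forall>s \<in> Sub A Y. belongs A (i \<cdot> w) s \<longrightarrow> z \<sqsubseteq>\<^bsub>SubO A Y\<^esub> s"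
          using least_containing[OF iw] .
        have "z \<sqsubseteq>\<^bsub>SubO A Y\<^esub> \<Sqinter>\<^bsub>SubO A Y\<^esub> S"
        proof (rule L.inf_greatest[OF SY z(1)])
          fix s assume s: "s \<in> S"
          show "z \<sqsubseteq>\<^bsub>SubO A Y\<^esub> s" by (rule z(3)[rule_format, OF subsetD[OF SY s] in_all[OF s]])
        qed
        then have "belongs A (i \<cdot> w) (\<Sqinter>\<^bsub>SubO A Y\<^esub> S)" by (rule belongs_le[OF iw z(2) _ z(1) IY])
        then show "belongs A w (preimg A i (\<Sqinter>\<^bsub>SubO A Y\<^esub> S))" using belongs_preimg[OF i IY w] by simp
      qed
      ultimately show "\<Sqinter>\<^bsub>SubO A Y\<^esub> S \<in> push_pnbd A Y i \<mu> m"
        using filter_mono[OF flt[OF m] _ pS[OF IY]] IY by (simp add: push_pnbd_def)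
    qed
    { fix n assume n: "n \<in> Sub A Y" "m \<sqsubseteq>\<^bsub>SubO A Y\<^esub> n"
      have "\<mu> (preimg A i n) \<subseteq> \<mu> (preimg A i m)"
        by (rule pnbd_system_antimono[OF \<mu> pS[OF m] pS[OF n(1)] preimg_mono[OF i m n]])
      then show "push_pnbd A Y i \<mu> n \<subseteq> push_pnbd A Y i \<mu> m" by (auto simp: push_pnbd_def) }
    { fix p assume "p \<in> push_pnbd A Y i \<mu> m"
      then have p: "p \<in> Sub A Y" and ip: "preimg A i p \<in> \<mu> (preimg A i m)"
        by (auto simp: push_pnbd_def)
      show "m \<sqsubseteq>\<^bsub>SubO A Y\<^esub> p"
        using preimg_mono[OF j pS[OF m] pS[OF p] pnbd_systemD(2)[OF \<mu> pS[OF m] ip]]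
          preimg_inverse[OF j i ij m] preimg_inverse[OF j i ij p] by simp }
  next
    have "\<mu> (sub_bot A X) = Sub A X" using \<mu> by (simp add: pnbd_system_def)
    then show "push_pnbd A Y i \<mu> (sub_bot A Y) = Sub A Y"
      using pS preimg_sub_bot[OF i j ji] by (auto simp: push_pnbd_def)
  qed
  then show ?thesis using YO by (simp add: pnbd_space_def)
qed

lemma push_mor:
  assumes i: "i \<in> hom A X Y" and j: "j \<in> hom A Y X" and ji: "j \<cdot> i = Ident A X"
    and ij: "i \<cdot> j = Ident A Y" and X: "pnbd_space A (X, \<mu>)"
  shows "pnbd_mor A (Y, push_pnbd A Y i \<mu>) (X, \<mu>) j"
proof -
  have \<mu>: "pnbd_system A X \<mu>" using X by (simp add: pnbd_space_def)
  have "preimg A j p \<in> push_pnbd A Y i \<mu> (preimg A j u)" if u: "u \<in> Sub A X" and p: "p \<in> \<mu> u" for u p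
  proof -
    note pX = pnbd_systemD(1)[OF \<mu> u p]
    show ?thesis
      using preimg_Sub[OF j pX] preimg_inverse[OF i j ji pX] preimg_inverse[OF i j ji u] p
      by (simp add: push_pnbd_def)
  qed
  then show ?thesis using push_space[OF assms] X j by (simp add: pnbd_mor_def)
qed

end

section \<open>Separated morphisms are the monomorphisms\<close>

context pnbd_context
begin

lemma pnbd_pullbackD:
  assumes "pnbd_pullback A S T f g (P, \<pi>) p q"
  shows "is_pullback A f g p q" "pnbd_mor A (P, \<pi>) S p" "pnbd_mor A (P, \<pi>) T q"
    "pnbd_mor A (P, \<pi>') S p \<Longrightarrow> pnbd_mor A (P, \<pi>') T q \<Longrightarrow> m \<in> Sub A P \<Longrightarrow> \<pi> m \<subseteq> \<pi>' m"
  using assms by (simp_all add: pnbd_pullback_def)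

text \<open>
  Images along an isomorphism are preimages along its inverse, so the elementwise description of
  preimages also applies to them.
\<close>
lemma img_iso:
  assumes q: "q \<in> hom A P R" and k: "k \<in> hom A R P" and kq: "k \<cdot> q = Ident A P"
    and qk: "q \<cdot> k = Ident A R" and x: "x \<in> Sub A P"
  shows "img A q x = preimg A k x"
proof -
  obtain m M where m: "m \<in> MM A" "m \<in> hom A M P" "x = sub_class A m" using Sub_cases x .
  have qm: "q \<cdot> m \<in> hom A M R" by (rule comp[OF m(2) q])
  have qmM: "q \<cdot> m \<in> MM A"
    using MM_comp[OF m(1) iso_MM[OF isoI[OF q k kq qk]]] m(2) q by (simp add: hom_def)
  have "img A q x = sub_class A (q \<cdot> m)" unfolding m(3) by (rule img_class[OF q m(1,2) qmM])
  also have "\<dots> = preimg A k x"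
  proof (rule Sub_eqI[OF sub_classI[OF qmM qm] preimg_Sub[OF k x]])
    fix V w assume w: "w \<in> hom A V R"
    have "(\<exists>t \<in> hom A V M. w = (q \<cdot> m) \<cdot> t) \<longleftrightarrow> (\<exists>t \<in> hom A V M. k \<cdot> w = m \<cdot> t)"
    proof (rule bex_cong[OF refl])
      fix t assume t: "t \<in> hom A V M"
      have mt: "m \<cdot> t \<in> hom A V P" by (rule comp[OF t m(2)])
      have e: "(q \<cdot> m) \<cdot> t = q \<cdot> (m \<cdot> t)" by (rule assoc[OF t m(2) q, symmetric])
      show "w = (q \<cdot> m) \<cdot> t \<longleftrightarrow> k \<cdot> w = m \<cdot> t"
      proof
        assume "w = (q \<cdot> m) \<cdot> t"
        then show "k \<cdot> w = m \<cdot> t" unfolding e using assoc[OF mt q k] kq comp_ident[OF mt] by simp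
      next
        assume "k \<cdot> w = m \<cdot> t"
        then have "(q \<cdot> m) \<cdot> t = q \<cdot> (k \<cdot> w)" unfolding e by simp
        then show "w = (q \<cdot> m) \<cdot> t" using assoc[OF w k q] qk comp_ident[OF w] by simp
      qed
    qed
    then show "belongs A w (sub_class A (q \<cdot> m)) \<longleftrightarrow> belongs A w (preimg A k x)"
      using belongs_factor[OF qmM qm w] belongs_preimg[OF k x w]
        belongs_factor[OF m(1,2) comp[OF w k]] m(3) by simp
  qed
  finally show ?thesis .
qed

text \<open>
  A pullback \<open>q\<close> of an isomorphism of spaces is an isomorphism of the underlying category. The
  system of \<open>R\<close> transported along its inverse \<open>k\<close> makes both projections morphisms, so it contains
  the pullback system by minimality. Hence the disjoint preneighbourhoods that witness the
  closedness of \<open>x\<close> are carried over to \<open>R\<close>.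
\<close>
lemma proper_iso:
  assumes d: "pnbd_mor A (X, \<mu>) (K, \<kappa>) d" and j: "pnbd_mor A (K, \<kappa>) (X, \<mu>) j"
    and jd: "j \<cdot> d = Ident A X" and dj: "d \<cdot> j = Ident A K"
  shows "proper_mor A (X, \<mu>) (K, \<kappa>) d"
  unfolding proper_mor_def stably_def
proof (intro conjI allI impI; (elim conjE)?)
  show "pnbd_mor A (X, \<mu>) (K, \<kappa>) d" by (rule d)
  fix RS h PS p q assume h': "pnbd_mor A RS (K, \<kappa>) h" and pb': "pnbd_pullback A (X, \<mu>) RS d h PS p q"
  obtain R \<rho> P \<pi> where RS: "RS = (R, \<rho>)" and PS: "PS = (P, \<pi>)" by fastforce
  note h = h'[unfolded RS]
  note pb = pnbd_pullbackD(1)[OF pb'[unfolded RS PS]] and p = pnbd_pullbackD(2)[OF pb'[unfolded RS PS]]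
    and q = pnbd_pullbackD(3)[OF pb'[unfolded RS PS]]
    and least = pnbd_pullbackD(4)[OF pb'[unfolded RS PS]]
  note dh = pnbd_morD(1)[OF d] and jh = pnbd_morD(1)[OF j] and hh = pnbd_morD(1)[OF h]
    and ph = pnbd_morD(1)[OF p] and qh = pnbd_morD(1)[OF q]
  have RO: "R \<in> Obj A" "P \<in> Obj A" using Obj_hom qh by blast+
  have D: "Dom A p = P" using ph by (simp add: hom_def)
  have jhh: "j \<cdot> h \<in> hom A R X" by (rule comp[OF hh jh])
  have "d \<cdot> (j \<cdot> h) = h \<cdot> Ident A R"
    using assoc[OF hh jh dh] dj comp_ident[OF hh] by simp
  then obtain k where k: "k \<in> hom A R P" and pk: "p \<cdot> k = j \<cdot> h" and qk: "q \<cdot> k = Ident A R"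
    using is_pullback_lift[OF pb dh hh jhh ident[OF RO(1)]] unfolding D by metis
  have pq: "p = (j \<cdot> h) \<cdot> q"
  proof -
    have "(j \<cdot> h) \<cdot> q = j \<cdot> (h \<cdot> q)" by (rule assoc[OF qh hh jh, symmetric])
    also have "\<dots> = j \<cdot> (d \<cdot> p)" using is_pullbackD(3)[OF pb dh hh] by simp
    also have "\<dots> = p" using assoc[OF ph dh jh] jd comp_ident[OF ph] by simp
    finally show ?thesis by simp
  qed
  have kq: "k \<cdot> q = Ident A P"
  proof (rule is_pullback_eqI[OF pb dh hh, unfolded D])
    show "k \<cdot> q \<in> hom A P P" by (rule comp[OF qh k])
    show "Ident A P \<in> hom A P P" by (rule ident[OF RO(2)])
    show "p \<cdot> (k \<cdot> q) = p \<cdot> Ident A P"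
      using assoc[OF qh k ph] pk pq comp_ident[OF ph] by simp
    show "q \<cdot> (k \<cdot> q) = q \<cdot> Ident A P"
      using assoc[OF qh k qh] qk comp_ident[OF qh] by simp
  qed
  have push_q: "pnbd_mor A (P, push_pnbd A P k \<rho>) (R, \<rho>) q"
    by (rule push_mor[OF k qh qk kq pnbd_morD(2)[OF h]])
  have push_p: "pnbd_mor A (P, push_pnbd A P k \<rho>) (X, \<mu>) p"
    using pnbd_mor_comp[OF push_q pnbd_mor_comp[OF h j]] pq by simp
  have "img A q x \<in> closed_subs A (R, \<rho>)" if x: "x \<in> closed_subs A (P, \<pi>)" for x
  proof -
    have xP: "x \<in> Sub A P" using x by (simp add: closed_subs_def)
    have kx: "preimg A k x \<in> Sub A R" by (rule preimg_Sub[OF k xP])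
    show ?thesis
      unfolding img_iso[OF qh k kq qk xP] closed_subs_iff[OF RO(1) pnbd_morD(7)[OF q] kx]
    proof
      fix y assume y: "y \<in> Sub A R"
      have qy: "preimg A q y \<in> Sub A P" by (rule preimg_Sub[OF qh y])
      have kqy: "preimg A k (preimg A q y) = y" by (rule preimg_inverse[OF k qh qk y])
      consider "preimg A q y \<sqsubseteq>\<^bsub>SubO A P\<^esub> x" | "x \<sqsubseteq>\<^bsub>SubO A P\<^esub> preimg A q y"
        | u where "u \<in> \<pi> (preimg A q y)" "u \<sqinter>\<^bsub>SubO A P\<^esub> x = sub_bot A P"
        using x qy unfolding closed_subs_iff[OF RO(2) pnbd_morD(6)[OF q] xP] by blast
      then show "y \<sqsubseteq>\<^bsub>SubO A R\<^esub> preimg A k x \<or> preimg A k x \<sqsubseteq>\<^bsub>SubO A R\<^esub> y \<or>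
          (\<exists>u\<in>\<rho> y. u \<sqinter>\<^bsub>SubO A R\<^esub> preimg A k x = sub_bot A R)"
      proof cases
        case 1
        then show ?thesis using preimg_mono[OF k qy xP] kqy by simp
      next
        case 2
        then show ?thesis using preimg_mono[OF k xP qy] kqy by simp
      next
        case (3 u)
        have u: "u \<in> Sub A P" by (rule pnbd_systemD(1)[OF pnbd_morD(6)[OF q] qy 3(1)])
        have "u \<in> push_pnbd A P k \<rho> (preimg A q y)" by (rule subsetD[OF least[OF push_p push_q qy] 3(1)])
        then have ku: "preimg A k u \<in> \<rho> y" using kqy by (simp add: push_pnbd_def)
        have "preimg A k u \<sqinter>\<^bsub>SubO A R\<^esub> preimg A k x = sub_bot A R"
          unfolding disjoint_iff[OF preimg_Sub[OF k u] kx]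
        proof (intro allI ballI impI)
          fix V w assume w: "w \<in> hom A V R" "belongs A w (preimg A k u)" "belongs A w (preimg A k x)"
          have "belongs A (k \<cdot> w) u" "belongs A (k \<cdot> w) x"
            using w belongs_preimg[OF k _ w(1)] u xP by blast+
          then have "belongs A (k \<cdot> w) (sub_bot A P)"
            using 3(2) comp[OF w(1) k] unfolding disjoint_iff[OF u xP] by blast
          then show "belongs A w (sub_bot A R)"
            using belongs_preimg[OF k sub_bot_Sub[OF RO(2)] w(1)] preimg_sub_bot[OF k qh qk] by simp
        qed
        then show ?thesis using ku by blast
      qed
    qed
  qed
  then show "closed_mor A PS RS q" using qh by (simp add: closed_mor_def RS PS)
qed

text \<open>
  The two projections \<open>p\<close>, \<open>q\<close> of the kernel pair agree and are inverse to the diagonal \<open>d\<close>.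
  That \<open>d\<close> is a morphism of spaces follows from minimality of the system on the kernel pair: it
  lies below the system transported along \<open>d\<close>.
\<close>
lemma separated_if_monic:
  assumes f: "pnbd_mor A (X, \<mu>) (Y, \<phi>) f" and mono: "monic A f"
  shows "separated_mor A (X, \<mu>) (Y, \<phi>) f"
  unfolding separated_mor_def
proof (intro conjI allI impI; (elim conjE)?)
  show "pnbd_mor A (X, \<mu>) (Y, \<phi>) f" by (rule f)
  fix KS p q d assume pb': "pnbd_pullback A (X, \<mu>) (X, \<mu>) f f KS p q"
    and d': "d \<in> hom A (fst (X, \<mu>)) (fst KS)" and pd': "p \<cdot> d = Ident A (fst (X, \<mu>))"
  obtain K \<kappa> where KS: "KS = (K, \<kappa>)" by fastforce
  have d: "d \<in> hom A X K" and pd: "p \<cdot> d = Ident A X" using d' pd' by (auto simp: KS)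
  note pb = pnbd_pullbackD(1)[OF pb'[unfolded KS]] and p = pnbd_pullbackD(2)[OF pb'[unfolded KS]]
    and q = pnbd_pullbackD(3)[OF pb'[unfolded KS]] and least = pnbd_pullbackD(4)[OF pb'[unfolded KS]]
  note fh = pnbd_morD(1)[OF f] and ph = pnbd_morD(1)[OF p] and qh = pnbd_morD(1)[OF q]
  have pq: "p = q" by (rule monicD[OF mono fh ph qh is_pullbackD(3)[OF pb fh fh]])
  have D: "Dom A p = K" using ph by (simp add: hom_def)
  have dp: "d \<cdot> p = Ident A K"
  proof (rule is_pullback_eqI[OF pb fh fh, unfolded D])
    show "d \<cdot> p \<in> hom A K K" by (rule comp[OF ph d])
    show "Ident A K \<in> hom A K K" by (rule ident[OF pnbd_morD(4)[OF p]])
    show "p \<cdot> (d \<cdot> p) = p \<cdot> Ident A K"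
      using assoc[OF ph d ph] pd comp_ident[OF ph] by simp
    then show "q \<cdot> (d \<cdot> p) = q \<cdot> Ident A K" unfolding pq .
  qed
  have push: "pnbd_mor A (K, push_pnbd A K d \<mu>) (X, \<mu>) p"
    by (rule push_mor[OF d ph pd dp pnbd_morD(2)[OF f]])
  have "preimg A d r \<in> \<mu> (preimg A d u)" if u: "u \<in> Sub A K" and r: "r \<in> \<kappa> u" for u r
    using subsetD[OF least[OF push push[unfolded pq] u] r] by (simp add: push_pnbd_def)
  then have "pnbd_mor A (X, \<mu>) (K, \<kappa>) d"
    using d pnbd_morD(2)[OF f] pnbd_morD(2)[OF p] by (simp add: pnbd_mor_def)
  from proper_iso[OF this p pd dp] show "proper_mor A (X, \<mu>) KS d" unfolding KS .
qed

lemma top_closed: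
  assumes X: "X \<in> Obj A" and \<mu>: "pnbd_system A X \<mu>"
  shows "sub_class A (Ident A X) \<in> closed_subs A (X, \<mu>)"
proof -
  have i: "Ident A X \<in> MM A" "Ident A X \<in> hom A X X" using iso_MM Ident_iso ident X by blast+
  have "belongs A w (sub_class A (Ident A X))" if w: "w \<in> hom A V X" for V w
    using w comp_ident[OF w] belongs_factor[OF i w] by metis
  then show ?thesis
    using closed_subs_iff[OF X \<mu> sub_classI[OF i]] le_iff sub_classI[OF i] by blast
qed

text \<open>
  Closedness is tested in the discrete space on the fibre product \<open>W\<close> of the kernel pair with
  itself over \<open>Y\<close>. There the pullbacks \<open>E\<close> and \<open>F\<close> of the diagonal along the two projections are
  comparable or disjoint, and each of these alternatives forces the kernel pair to be trivial.
\<close>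
lemma monic_if_separated:
  assumes sep: "separated_mor A (X, \<mu>) (Y, \<phi>) f"
  shows "monic A f"
proof -
  have f: "pnbd_mor A (X, \<mu>) (Y, \<phi>) f" using sep by (simp add: separated_mor_def)
  note fh = pnbd_morD(1)[OF f]
  have XO: "X \<in> Obj A" using Obj_hom fh by blast
  obtain K p q where pb: "is_pullback A f f p q" and p: "p \<in> hom A K X" and q: "q \<in> hom A K X"
    using pullback_exists[OF fh fh] .
  have DK: "Dom A p = K" using p by (simp add: hom_def)
  have KO: "K \<in> Obj A" using Obj_hom p by blast
  obtain \<kappa> where kp: "pnbd_pullback A (X, \<mu>) (X, \<mu>) f f (K, \<kappa>) p q"
    using pnbd_pullback_exists[OF pnbd_morD(2)[OF f] pnbd_morD(2)[OF f] pb p q] .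
  obtain d where d: "d \<in> hom A X K" and pd: "p \<cdot> d = Ident A X" and qd: "q \<cdot> d = Ident A X"
    using is_pullback_lift[OF pb fh fh ident[OF XO] ident[OF XO] refl] unfolding DK by metis
  have pr: "proper_mor A (X, \<mu>) (K, \<kappa>) d"
    using sep kp d pd qd unfolding separated_mor_def by simp
  have dM: "d \<in> MM A" by (rule split_monic_MM[OF d p pd])
  \<comment> \<open>The elements of the diagonal are those with equal components.\<close>
  have in_d: "p \<cdot> w = q \<cdot> w" if w: "w \<in> hom A V K" and b: "belongs A w (sub_class A d)" for V w
  proof -
    obtain l where l: "l \<in> hom A V X" "w = d \<cdot> l" using b belongs_factor[OF dM d w] by blast
    show ?thesis unfolding l(2) using assoc[OF l(1) d p] assoc[OF l(1) d q] pd qd by simp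
  qed
  have d_in: "belongs A (d \<cdot> l) (sub_class A d)" if l: "l \<in> hom A V X" for V l
    using belongs_factor[OF dM d comp[OF l d]] l by blast
  define c where "c = f \<cdot> p"
  have c: "c \<in> hom A K Y" unfolding c_def by (rule comp[OF p fh])
  obtain W r s where pw: "is_pullback A c c r s" and r: "r \<in> hom A W K" and s: "s \<in> hom A W K"
    using pullback_exists[OF c c] .
  have DW: "Dom A r = W" using r by (simp add: hom_def)
  have WO: "W \<in> Obj A" using Obj_hom r by blast
  have Ks: "pnbd_space A (K, \<kappa>)"
    by (rule pnbd_morD(2)[OF pnbd_pullbackD(2)[OF kp]])
  have rm: "pnbd_mor A (W, discrete_pnbd A W) (K, \<kappa>) r" by (rule discrete_mor[OF r Ks])
  obtain P a b where pe: "is_pullback A d r a b" and a: "a \<in> hom A P X" and b: "b \<in> hom A P W"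
    using pullback_exists[OF d r] .
  obtain \<pi> where ke: "pnbd_pullback A (X, \<mu>) (W, discrete_pnbd A W) d r (P, \<pi>) a b"
    using pnbd_pullback_exists[OF pnbd_morD(2)[OF f] discrete_space[OF WO] pe a b] .
  have closed: "closed_mor A (P, \<pi>) (W, discrete_pnbd A W) b"
    using pr rm ke unfolding proper_mor_def stably_def by blast
  have PO: "P \<in> Obj A" using Obj_hom a by blast
  have \<pi>: "pnbd_system A P \<pi>"
    by (rule pnbd_morD(6)[OF pnbd_pullbackD(2)[OF ke]])
  have bM: "b \<in> MM A" by (rule MM_pullback[OF is_pullback_sym[OF pe] r dM d])
  have b1: "b \<cdot> Ident A P = b" using comp_ident[OF b] by blast
  have "img A b (sub_class A (Ident A P)) = sub_class A b"
    using img_class[OF b iso_MM[OF Ident_iso[OF PO]] ident[OF PO]] b1 bM by simp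
  also have "\<dots> = preimg A r (sub_class A d)"
    by (rule preimg_class[OF is_pullback_sym[OF pe] r dM d, symmetric])
  finally have "preimg A r (sub_class A d) \<in> closed_subs A (W, discrete_pnbd A W)"
    using closed top_closed[OF PO \<pi>] unfolding closed_mor_def by metis
  define E where "E = preimg A r (sub_class A d)"
  define F where "F = preimg A s (sub_class A d)"
  have dS: "sub_class A d \<in> Sub A K" by (rule sub_classI[OF dM d])
  have ES: "E \<in> Sub A W" and FS: "F \<in> Sub A W" using preimg_Sub r s dS by (auto simp: E_def F_def)
  have disc: "pnbd_system A W (discrete_pnbd A W)"
    using discrete_space[OF WO] by (simp add: pnbd_space_def)
  have inE: "belongs A w E \<longleftrightarrow> belongs A (r \<cdot> w) (sub_class A d)"
    and inF: "belongs A w F \<longleftrightarrow> belongs A (s \<cdot> w) (sub_class A d)" if w: "w \<in> hom A V W" for V w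
    using belongs_preimg[OF r dS w] belongs_preimg[OF s dS w] by (simp_all add: E_def F_def)
  have K1: "Ident A K \<in> hom A K K" by (rule ident[OF KO])
  have dp: "d \<cdot> p \<in> hom A K K" and dq: "d \<cdot> q \<in> hom A K K" using comp[OF p d] comp[OF q d] .
  have pdp: "p \<cdot> (d \<cdot> p) = p" "p \<cdot> (d \<cdot> q) = q"
    using assoc[OF p d p] assoc[OF q d p] pd comp_ident[OF p] comp_ident[OF q] by simp_all
  have fpq: "f \<cdot> p = f \<cdot> q" by (rule is_pullbackD(3)[OF pb fh fh])
  have c1: "c \<cdot> Ident A K = c" "c \<cdot> (d \<cdot> p) = c" "c \<cdot> (d \<cdot> q) = c"
    using comp_ident[OF c] assoc[OF dp p fh] assoc[OF dq p fh] pdp fpq by (simp_all add: c_def)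
  have one: "p = q" if "belongs A (Ident A K) (sub_class A d)"
    using in_d[OF K1 that] comp_ident[OF p] comp_ident[OF q] by simp
  consider "F \<sqsubseteq>\<^bsub>SubO A W\<^esub> E" | "E \<sqsubseteq>\<^bsub>SubO A W\<^esub> F"
    | u where "u \<in> discrete_pnbd A W F" "u \<sqinter>\<^bsub>SubO A W\<^esub> E = sub_bot A W"
    using \<open>preimg A r (sub_class A d) \<in> _\<close> FS
    unfolding E_def[symmetric] closed_subs_iff[OF WO disc ES] by blast
  then have "p = q"
  proof cases
    case 1
    obtain t where t: "t \<in> hom A K W" "r \<cdot> t = Ident A K" "s \<cdot> t = d \<cdot> p"
      using is_pullback_lift[OF pw c c K1 dp] c1 unfolding DW by metis
    have "belongs A t F" using inF[OF t(1)] t(3) d_in[OF p] by simp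
    then have "belongs A t E" using belongs_le[OF t(1) _ 1 FS ES] by blast
    then show ?thesis using inE[OF t(1)] t(2) one by simp
  next
    case 2
    obtain t where t: "t \<in> hom A K W" "r \<cdot> t = d \<cdot> p" "s \<cdot> t = Ident A K"
      using is_pullback_lift[OF pw c c dp K1] c1 unfolding DW by metis
    have "belongs A t E" using inE[OF t(1)] t(2) d_in[OF p] by simp
    then have "belongs A t F" using belongs_le[OF t(1) _ 2 ES FS] by blast
    then show ?thesis using inF[OF t(1)] t(3) one by simp
  next
    case (3 u)
    \<comment> \<open>This element lies in both \<open>E\<close> and \<open>F\<close>, hence in the smallest subobject.\<close>
    obtain t where t: "t \<in> hom A K W" "r \<cdot> t = d \<cdot> p" "s \<cdot> t = d \<cdot> q"
      using is_pullback_lift[OF pw c c dp dq] c1 unfolding DW by metis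
    have u: "u \<in> Sub A W" "F \<sqsubseteq>\<^bsub>SubO A W\<^esub> u" using 3(1) by (simp_all add: discrete_pnbd_def)
    have tE: "belongs A t E" using inE[OF t(1)] t(2) d_in[OF p] by simp
    have "belongs A t F" using inF[OF t(1)] t(3) d_in[OF q] by simp
    then have "belongs A t u" using belongs_le[OF t(1) _ u(2) FS u(1)] by blast
    then have "belongs A t (sub_bot A W)"
      using 3(2) tE t(1) unfolding disjoint_iff[OF u(1) ES] by blast
    from belongs_sub_bot_eq[OF t(1) this comp[OF r p] comp[OF s p]]
    have "p \<cdot> (r \<cdot> t) = p \<cdot> (s \<cdot> t)" using assoc[OF t(1) r p] assoc[OF t(1) s p] by simp
    then show ?thesis unfolding t(2,3) pdp .
  qed
  show ?thesis
    unfolding monic_def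
  proof (intro conjI allI ballI impI)
    show "f \<in> Arr A" using fh by (simp add: hom_def)
    fix V u v assume "u \<in> hom A V (Dom A f)" "v \<in> hom A V (Dom A f)" and e: "f \<cdot> u = f \<cdot> v"
    then have u: "u \<in> hom A V X" and v: "v \<in> hom A V X" using fh by (simp_all add: hom_def)
    obtain k where "p \<cdot> k = u" "q \<cdot> k = v" using is_pullback_lift[OF pb fh fh u v e] by metis
    then show "u = v" using \<open>p = q\<close> by simp
  qed
qed

lemma separated_iff_monic:
  "separated_mor A (X, \<mu>) (Y, \<phi>) f \<longleftrightarrow> pnbd_mor A (X, \<mu>) (Y, \<phi>) f \<and> monic A f"
  using separated_if_monic monic_if_separated by (auto simp: separated_mor_def)

text \<open>
  A pair of morphisms of the underlying category that tests monicity is a pair of morphisms of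
  spaces once its domain is made discrete.
\<close>
lemma monic_if_pnbd_monic:
  assumes "pnbd_monic A (X, \<mu>) (Y, \<phi>) f"
  shows "monic A f"
proof -
  have f: "pnbd_mor A (X, \<mu>) (Y, \<phi>) f" using assms by (simp add: pnbd_monic_def)
  note fh = pnbd_morD(1)[OF f]
  show ?thesis
    unfolding monic_def
  proof (intro conjI allI ballI impI)
    show "f \<in> Arr A" using fh by (simp add: hom_def)
    fix V u v assume "u \<in> hom A V (Dom A f)" "v \<in> hom A V (Dom A f)" and e: "f \<cdot> u = f \<cdot> v"
    then have "u \<in> hom A V X" "v \<in> hom A V X" using fh by (simp_all add: hom_def)
    then have "pnbd_mor A (V, discrete_pnbd A V) (X, \<mu>) u" "pnbd_mor A (V, discrete_pnbd A V) (X, \<mu>) v"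
      using discrete_mor pnbd_morD(2)[OF f] by blast+
    then show "u = v" using assms e unfolding pnbd_monic_def by blast
  qed
qed

text \<open>
  Every element of \<open>Y\<close> lifts along \<open>f\<close> after restriction along a morphism in \<open>EE A\<close>.
\<close>
lemma stably_in_E_cover:
  assumes E: "stably_in_E A (X, \<mu>) (Y, \<phi>) f" and a: "a \<in> hom A V Y"
  obtains P p e where "e \<in> EE A" "e \<in> hom A P V" "p \<in> hom A P X" "f \<cdot> p = a \<cdot> e"
proof -
  have f: "pnbd_mor A (X, \<mu>) (Y, \<phi>) f" using E by (simp add: stably_in_E_def stably_def)
  note fh = pnbd_morD(1)[OF f]
  have VO: "V \<in> Obj A" using Obj_hom a by blast
  have am: "pnbd_mor A (V, discrete_pnbd A V) (Y, \<phi>) a" by (rule discrete_mor[OF a pnbd_morD(3)[OF f]])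
  obtain P p e where pb: "is_pullback A f a p e" and p: "p \<in> hom A P X" and e: "e \<in> hom A P V"
    using pullback_exists[OF fh a] .
  obtain \<pi> where "pnbd_pullback A (X, \<mu>) (V, discrete_pnbd A V) f a (P, \<pi>) p e"
    using pnbd_pullback_exists[OF pnbd_morD(2)[OF f] discrete_space[OF VO] pb p e] .
  then have "e \<in> EE A" using E am unfolding stably_in_E_def stably_def by blast
  then show ?thesis using that e p is_pullbackD(3)[OF pb fh a] by blast
qed

text \<open>
  Two elements \<open>a\<close>, \<open>b\<close> of \<open>Y\<close> with the same image under \<open>g\<close> are lifted along \<open>f\<close> one after
  the other. The lifts agree because \<open>g \<cdot> f\<close> is monic, so \<open>a\<close> and \<open>b\<close> agree after precomposition
  with two epimorphisms.
\<close>
lemma monic_descends: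
  assumes E: "stably_in_E A (X, \<mu>) (Y, \<phi>) f" and g: "g \<in> hom A Y Z" and mono: "monic A (g \<cdot> f)"
  shows "monic A g"
  unfolding monic_def
proof (intro conjI allI ballI impI)
  have f: "f \<in> hom A X Y" using E pnbd_morD(1) by (fastforce simp: stably_in_E_def stably_def)
  show "g \<in> Arr A" using g by (simp add: hom_def)
  fix V a b assume "a \<in> hom A V (Dom A g)" "b \<in> hom A V (Dom A g)" and ab: "g \<cdot> a = g \<cdot> b"
  then have a: "a \<in> hom A V Y" and b: "b \<in> hom A V Y" using g by (simp_all add: hom_def)
  obtain P p d where d: "d \<in> EE A" "d \<in> hom A P V" and p: "p \<in> hom A P X" "f \<cdot> p = a \<cdot> d"
    using stably_in_E_cover[OF E a] .
  have bd: "b \<cdot> d \<in> hom A P Y" and ad: "a \<cdot> d \<in> hom A P Y"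
    by (rule comp[OF d(2) b], rule comp[OF d(2) a])
  obtain Q q e where e: "e \<in> EE A" "e \<in> hom A Q P" and q: "q \<in> hom A Q X" "f \<cdot> q = (b \<cdot> d) \<cdot> e"
    using stably_in_E_cover[OF E bd] .
  have pe: "p \<cdot> e \<in> hom A Q X" by (rule comp[OF e(2) p(1)])
  have gd: "g \<cdot> (a \<cdot> d) = g \<cdot> (b \<cdot> d)" using assoc[OF d(2) a g] assoc[OF d(2) b g] ab by simp
  have fpe: "f \<cdot> (p \<cdot> e) = (a \<cdot> d) \<cdot> e" using assoc[OF e(2) p(1) f] p(2) by simp
  have "g \<cdot> (f \<cdot> (p \<cdot> e)) = g \<cdot> (f \<cdot> q)"
    unfolding fpe q(2) using assoc[OF e(2) ad g] assoc[OF e(2) bd g] gd by simp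
  then have "(g \<cdot> f) \<cdot> (p \<cdot> e) = (g \<cdot> f) \<cdot> q" using assoc[OF pe f g] assoc[OF q(1) f g] by simp
  then have "p \<cdot> e = q" by (rule monicD[OF mono comp[OF f g] pe q(1)])
  then have "(a \<cdot> d) \<cdot> e = (b \<cdot> d) \<cdot> e" using fpe q(2) by simp
  then have "a \<cdot> d = b \<cdot> d" by (rule epicD[OF EE_epic[OF e(1)] e(2) ad bd])
  then show "a = b" by (rule epicD[OF EE_epic[OF d(1)] d(2) a b])
qed

end

section \<open>The stability properties\<close>

theorem mainTheorem16:
  fixes A :: "('o, 'a) fact_category"
    and X Y Z :: 'o
    and \<mu> \<phi> \<psi> :: "'a pnbd"
    and f g :: 'a
  assumes "pnbd_context A"
    and "pnbd_mor A (X, \<mu>) (Y, \<phi>) f"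
    and "pnbd_mor A (Y, \<phi>) (Z, \<psi>) g"
  shows
    "(\<forall>S T h. pnbd_monic A S T h \<longrightarrow> separated_mor A S T h) \<and>
     (\<forall>S T h R k P p q.
        separated_mor A S T h \<and> pnbd_mor A R T k \<and> pnbd_pullback A S R h k P p q \<longrightarrow>
        separated_mor A P R q) \<and>
     (separated_mor A (Y, \<phi>) (Z, \<psi>) g \<and> separated_mor A (X, \<mu>) (Y, \<phi>) f \<longrightarrow>
        separated_mor A (X, \<mu>) (Z, \<psi>) (g \<cdot>\<^bsub>A\<^esub> f)) \<and>
     (separated_mor A (X, \<mu>) (Z, \<psi>) (g \<cdot>\<^bsub>A\<^esub> f) \<and> proper_mor A (X, \<mu>) (Y, \<phi>) f \<and>
        stably_continuous A (X, \<mu>) (Y, \<phi>) f \<and> stably_in_E A (X, \<mu>) (Y, \<phi>) f \<longrightarrow>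
        separated_mor A (Y, \<phi>) (Z, \<psi>) g) \<and>
     (separated_mor A (X, \<mu>) (Z, \<psi>) (g \<cdot>\<^bsub>A\<^esub> f) \<longrightarrow> separated_mor A (X, \<mu>) (Y, \<phi>) f)"
proof -
  interpret pnbd_context A by (rule assms(1))
  note f = assms(2) and g = assms(3)
  note fh = pnbd_morD(1)[OF f] and gh = pnbd_morD(1)[OF g]
  have a: "separated_mor A S T h" if "pnbd_monic A S T h" for S T h
  proof (cases S; cases T)
    fix S1 \<sigma> T1 \<tau> assume [simp]: "S = (S1, \<sigma>)" "T = (T1, \<tau>)"
    show ?thesis using that monic_if_pnbd_monic by (simp add: separated_iff_monic pnbd_monic_def)
  qed
  have b: "separated_mor A P R q"
    if "separated_mor A S T h" "pnbd_mor A R T k" "pnbd_pullback A S R h k P p q" for S T h R k P p q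
  proof -
    obtain S1 \<sigma> where [simp]: "S = (S1, \<sigma>)" by fastforce
    obtain T1 \<tau> where [simp]: "T = (T1, \<tau>)" by fastforce
    obtain R1 \<rho> where [simp]: "R = (R1, \<rho>)" by fastforce
    obtain P1 \<pi> where [simp]: "P = (P1, \<pi>)" by fastforce
    have h: "pnbd_mor A (S1, \<sigma>) (T1, \<tau>) h" "monic A h" using that(1) by (simp_all add: separated_iff_monic)
    have k: "pnbd_mor A (R1, \<rho>) (T1, \<tau>) k" using that(2) by simp
    have pb: "is_pullback A h k p q" and q: "pnbd_mor A (P1, \<pi>) (R1, \<rho>) q"
      using that(3) by (simp_all add: pnbd_pullback_def)
    show ?thesis
      using q monic_pullback[OF pb pnbd_morD(1)[OF h(1)] pnbd_morD(1)[OF k] h(2)]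
      by (simp add: separated_iff_monic)
  qed
  have c: "separated_mor A (X, \<mu>) (Z, \<psi>) (g \<cdot>\<^bsub>A\<^esub> f)"
    if "separated_mor A (Y, \<phi>) (Z, \<psi>) g" "separated_mor A (X, \<mu>) (Y, \<phi>) f"
    using that monic_comp[OF _ _ fh gh] pnbd_mor_comp[OF f g] by (simp add: separated_iff_monic)
  have d: "separated_mor A (Y, \<phi>) (Z, \<psi>) g"
    if "separated_mor A (X, \<mu>) (Z, \<psi>) (g \<cdot>\<^bsub>A\<^esub> f)" "stably_in_E A (X, \<mu>) (Y, \<phi>) f"
    using that g monic_descends[OF that(2) gh] by (simp add: separated_iff_monic)
  have e: "separated_mor A (X, \<mu>) (Y, \<phi>) f" if "separated_mor A (X, \<mu>) (Z, \<psi>) (g \<cdot>\<^bsub>A\<^esub> f)"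
    using that f monic_comp_cancel[OF _ fh gh] by (simp add: separated_iff_monic)
  show ?thesis using a b c d e by blast
qed

end
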